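(* Let $\mathcal{A}$ be a unital $C^*$-algebra, $\mathcal{H}$ a Hilbert space, and $L(\mathcal{H})$ the algebra of bounded linear operators on $\mathcal{H}$. Let $\phi:\mathcal{A}\to L(\mathcal{H})$ be a positive contractive linear map and let $1\leq r\leq s$ be real numbers. Then $$\phi(a^r)^{1/r}\leq\phi(a^s)^{1/s}\qquad\text{for every positive } a\in\mathcal{A}.$$
   Context: A linear map between $C^*$-algebras is positive if it maps positive elements to positive elements; it is contractive if its norm is at most $1$. Real powers of positive elements are defined by continuous functional calculus. *)

theory Defs
  imports "HOL-Analysis.Analysis"
begin

section \<open>Complex normed spaces, Hilbert spaces, unital C*-algebras\<close>

class scaleC =
  fixes scaleC :: "complex \<Rightarrow> 'a \<Rightarrow> 'a"  (infixr \<open>*\<^sub>C\<close> 75)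

class complex_normed_space = real_normed_vector + scaleC +
  assumes scaleC_add_right: "c *\<^sub>C (x + y) = c *\<^sub>C x + c *\<^sub>C y"
    and scaleC_add_left: "(c + d) *\<^sub>C x = c *\<^sub>C x + d *\<^sub>C x"
    and scaleC_scaleC: "c *\<^sub>C d *\<^sub>C x = (c * d) *\<^sub>C x"
    and scaleR_scaleC: "r *\<^sub>R x = complex_of_real r *\<^sub>C x"
    and norm_scaleC: "norm (c *\<^sub>C x) = cmod c * norm x"

text \<open>The inner product is linear in the first and conjugate-linear in the second argument.\<close>

class complex_inner = complex_normed_space +
  fixes cinner :: "'a \<Rightarrow> 'a \<Rightarrow> complex"
  assumes cinner_commute: "cinner x y = cnj (cinner y x)"
    and cinner_add_left: "cinner (x + y) z = cinner x z + cinner y z"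
    and cinner_scaleC_left: "cinner (c *\<^sub>C x) y = c * cinner x y"
    and cinner_ge_zero: "0 \<le> Re (cinner x x)"
    and norm_eq_sqrt_cinner: "norm x = sqrt (Re (cinner x x))"

class complex_hilbert_space = complex_inner + banach

text \<open>
  The unit is provided by \<^class>\<open>monoid_mult\<close> rather than \<^class>\<open>ring_1\<close>, so that the zero
  algebra (in particular the operators on the zero Hilbert space) is included.
\<close>

class unital_cstar_algebra = complex_normed_space + banach + real_normed_algebra + monoid_mult +
  fixes star :: "'a \<Rightarrow> 'a"
  assumes mult_scaleC_left: "(c *\<^sub>C x) * y = c *\<^sub>C (x * y)"
    and mult_scaleC_right: "x * (c *\<^sub>C y) = c *\<^sub>C (x * y)"
    and star_add: "star (x + y) = star x + star y"
    and star_scaleC: "star (c *\<^sub>C x) = cnj c *\<^sub>C star x"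
    and star_mult: "star (x * y) = star y * star x"
    and star_star: "star (star x) = x"
    and norm_star_mult_self: "norm (star x * x) = (norm x)\<^sup>2"


section \<open>Notions in a unital C*-algebra\<close>

definition spectrum :: "'a::unital_cstar_algebra \<Rightarrow> complex set" where
  "spectrum a = {z. \<not> (\<exists>b. b * (a - z *\<^sub>C 1) = 1 \<and> (a - z *\<^sub>C 1) * b = 1)}"

definition cstar_positive :: "'a::unital_cstar_algebra \<Rightarrow> bool" where
  "cstar_positive a \<longleftrightarrow> star a = a \<and> spectrum a \<subseteq> \<real>\<^sub>\<ge>\<^sub>0"

definition cstar_le :: "'a::unital_cstar_algebra \<Rightarrow> 'a \<Rightarrow> bool"  (infix \<open>\<preceq>\<close> 50) where
  "a \<preceq> b \<longleftrightarrow> cstar_positive (b - a)"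

text \<open>
  \<open>\<Phi>\<close> is a unital *-homomorphism from the algebra of continuous functions on the spectrum of \<open>a\<close>
  that maps the identity function to \<open>a\<close>.  Elements of that algebra are represented by functions
  on all of \<^typ>\<open>complex\<close> that are continuous on the spectrum; the first clause makes \<open>\<Phi>\<close>
  depend only on their restriction to the spectrum.
\<close>

definition is_functional_calculus ::
    "'a::unital_cstar_algebra \<Rightarrow> ((complex \<Rightarrow> complex) \<Rightarrow> 'a) \<Rightarrow> bool" where
  "is_functional_calculus a \<Phi> \<longleftrightarrow>
     (\<forall>f g. continuous_on (spectrum a) f \<longrightarrow> (\<forall>z\<in>spectrum a. f z = g z) \<longrightarrow> \<Phi> f = \<Phi> g) \<and>
     (\<forall>f g. continuous_on (spectrum a) f \<longrightarrow> continuous_on (spectrum a) g \<longrightarrow>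
        \<Phi> (\<lambda>z. f z + g z) = \<Phi> f + \<Phi> g \<and> \<Phi> (\<lambda>z. f z * g z) = \<Phi> f * \<Phi> g) \<and>
     (\<forall>c f. continuous_on (spectrum a) f \<longrightarrow> \<Phi> (\<lambda>z. c * f z) = c *\<^sub>C \<Phi> f) \<and>
     (\<forall>f. continuous_on (spectrum a) f \<longrightarrow> \<Phi> (\<lambda>z. cnj (f z)) = star (\<Phi> f)) \<and>
     \<Phi> (\<lambda>z. 1) = 1 \<and> \<Phi> (\<lambda>z. z) = a"

text \<open>
  For normal \<open>a\<close> and \<open>f\<close> continuous on the spectrum of \<open>a\<close> the value below is determined by
  existence and uniqueness of the functional calculus; otherwise it is unspecified.
\<close>

definition functional_calculus :: "'a::unital_cstar_algebra \<Rightarrow> (complex \<Rightarrow> complex) \<Rightarrow> 'a" where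
  "functional_calculus a f = (THE b. \<exists>\<Phi>. is_functional_calculus a \<Phi> \<and> b = \<Phi> f)"

text \<open>Meant for positive \<open>a\<close> and \<open>t > 0\<close>, where only the values \<open>Re z = z \<ge> 0\<close> matter.\<close>

definition cstar_powr :: "'a::unital_cstar_algebra \<Rightarrow> real \<Rightarrow> 'a" where
  "cstar_powr a t = functional_calculus a (\<lambda>z. complex_of_real (Re z powr t))"


section \<open>Linear maps\<close>

definition clinear :: "('a::complex_normed_space \<Rightarrow> 'b::complex_normed_space) \<Rightarrow> bool" where
  "clinear f \<longleftrightarrow> (\<forall>x y. f (x + y) = f x + f y) \<and> (\<forall>c x. f (c *\<^sub>C x) = c *\<^sub>C f x)"

definition positive_map :: "('a::unital_cstar_algebra \<Rightarrow> 'b::unital_cstar_algebra) \<Rightarrow> bool" where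
  "positive_map f \<longleftrightarrow> (\<forall>a. cstar_positive a \<longrightarrow> cstar_positive (f a))"

definition contractive :: "('a::complex_normed_space \<Rightarrow> 'b::complex_normed_space) \<Rightarrow> bool" where
  "contractive f \<longleftrightarrow> bounded_linear f \<and> onorm f \<le> 1"


section \<open>Inner product spaces and the Riesz representation theorem\<close>

lemma scaleC_one [simp]: "1 *\<^sub>C (x::'a::complex_normed_space) = x"
  by (metis of_real_1 scaleR_one scaleR_scaleC)

lemma scaleC_zero_right [simp]: "c *\<^sub>C 0 = (0::'a::complex_normed_space)"
  by (metis add_cancel_right_right scaleC_add_right)

lemma scaleC_diff_right: "c *\<^sub>C (x - y) = c *\<^sub>C x - c *\<^sub>C (y::'a::complex_normed_space)"
  by (metis diff_add_cancel eq_diff_eq scaleC_add_right)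

lemma scaleC_minus_right: "c *\<^sub>C (- x) = - (c *\<^sub>C (x::'a::complex_normed_space))"
  using scaleC_diff_right[of c 0 x] by simp

lemma bounded_linear_scaleC_right: "bounded_linear (\<lambda>x::'a::complex_normed_space. c *\<^sub>C x)"
  by (rule bounded_linear_intro[where K = "cmod c"])
     (simp_all add: scaleC_add_right scaleR_scaleC scaleC_scaleC norm_scaleC mult.commute)

lemma cinner_add_right: "cinner x (y + z) = cinner x y + cinner (x::'a::complex_inner) z"
  by (metis cinner_add_left cinner_commute complex_cnj_add)

lemma cinner_scaleC_right: "cinner x (c *\<^sub>C y) = cnj c * cinner (x::'a::complex_inner) y"
  by (metis cinner_scaleC_left cinner_commute complex_cnj_mult)

lemma cinner_scaleR_left: "cinner (r *\<^sub>R x) y = of_real r * cinner (x::'a::complex_inner) y"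
  by (simp add: scaleR_scaleC cinner_scaleC_left)

lemma cinner_scaleR_right: "cinner x (r *\<^sub>R y) = of_real r * cinner (x::'a::complex_inner) y"
  by (simp add: scaleR_scaleC cinner_scaleC_right)

lemma cinner_minus_left: "cinner (- x) y = - cinner (x::'a::complex_inner) y"
  using cinner_scaleR_left[of "-1" x y] by simp

lemma cinner_minus_right: "cinner y (- x) = - cinner y (x::'a::complex_inner)"
  using cinner_scaleR_right[of y "-1" x] by simp

lemma cinner_diff_left: "cinner (x - y) z = cinner x z - cinner (y::'a::complex_inner) z"
  using cinner_add_left[of x "- y" z] by (simp add: cinner_minus_left)

lemma cinner_diff_right: "cinner z (x - y) = cinner z x - cinner z (y::'a::complex_inner)"
  using cinner_add_right[of z x "- y"] by (simp add: cinner_minus_right)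

lemma Re_cinner_self: "Re (cinner x x) = (norm (x::'a::complex_inner))\<^sup>2"
  by (simp add: norm_eq_sqrt_cinner cinner_ge_zero)

lemma cinner_self: "cinner x x = of_real ((norm (x::'a::complex_inner))\<^sup>2)"
proof -
  have "Im (cinner x x) = 0"
    by (metis cinner_commute cnj.sel(2) neg_equal_zero)
  then show ?thesis
    by (simp add: complex_eq_iff Re_cinner_self)
qed

lemma Re_cinner_commute: "Re (cinner y x) = Re (cinner x (y::'a::complex_inner))"
  by (metis cinner_commute cnj.sel(1))

lemma norm_add_sqr:
  "(norm (x + y))\<^sup>2 = (norm x)\<^sup>2 + 2 * Re (cinner x y) + (norm (y::'a::complex_inner))\<^sup>2"
  unfolding Re_cinner_self[symmetric]
  by (simp add: cinner_add_left cinner_add_right Re_cinner_commute[of y x])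

lemma norm_diff_sqr:
  "(norm (x - y))\<^sup>2 = (norm x)\<^sup>2 - 2 * Re (cinner x y) + (norm (y::'a::complex_inner))\<^sup>2"
  using norm_add_sqr[of x "- y"] by (simp add: cinner_minus_right)

lemma cmod_cinner_le: "cmod (cinner x y) \<le> norm x * norm (y::'a::complex_inner)"
proof -
  have Re_le: "Re (cinner u v) \<le> norm u * norm v" for u v :: 'a
  proof -
    have "(norm (u + v))\<^sup>2 \<le> (norm u + norm v)\<^sup>2"
      by (simp add: norm_triangle_ineq power_mono)
    then show ?thesis
      unfolding norm_add_sqr by (simp add: power2_sum)
  qed
  define c where "c = (if cinner x y = 0 then 1 else cnj (sgn (cinner x y)))"
  have "cmod c = 1"
    by (simp add: c_def norm_sgn)
  moreover have "c * cinner x y = of_real (cmod (cinner x y))"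
    by (simp add: c_def sgn_eq complex_norm_square[symmetric] power2_eq_square mult.commute)
  then have "Re (cinner (c *\<^sub>C x) y) = cmod (cinner x y)"
    by (simp add: cinner_scaleC_left)
  ultimately show ?thesis
    using Re_le[of "c *\<^sub>C x" y] by (simp add: norm_scaleC)
qed

lemma cinner_eqI:
  fixes y z :: "'a::complex_inner"
  assumes "\<And>x. cinner x y = cinner x z"
  shows "y = z"
proof -
  have "cinner (y - z) (y - z) = 0"
    using assms[of "y - z"] by (simp add: cinner_diff_right)
  then show ?thesis
    by (simp add: cinner_self)
qed

lemma riesz_real:
  fixes g :: "'a::complex_hilbert_space \<Rightarrow> real"
  assumes "bounded_linear g"
  shows "\<exists>z. \<forall>x. g x = Re (cinner x z)"
proof -
  interpret g: bounded_linear g by fact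
  obtain K where K: "\<And>x. norm (g x) \<le> norm x * K"
    using g.bounded by blast
  define J where "J x = (norm x)\<^sup>2 / 2 - g x" for x
  have J_ge: "- K\<^sup>2 / 2 \<le> J x" for x
  proof -
    have "0 \<le> (norm x - K)\<^sup>2" by simp
    then have "norm x * K \<le> (norm x)\<^sup>2 / 2 + K\<^sup>2 / 2"
      by (simp add: power2_diff)
    with K[of x] show ?thesis
      unfolding J_def by auto
  qed
  define m where "m = Inf (range J)"
  have bdd: "bdd_below (range J)"
    using J_ge by (auto intro!: bdd_belowI)
  have m_le: "m \<le> J x" for x
    unfolding m_def using bdd by (intro cInf_lower) auto
  have "\<exists>x. J x < m + 1 / Suc n" for n
  proof -
    have "Inf (range J) < m + 1 / Suc n"
      by (simp add: m_def)
    from cInf_lessD[OF _ this] show ?thesis by auto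
  qed
  then obtain X where X: "\<And>n. J (X n) < m + 1 / Suc n"
    by metis
  have par: "(norm (x - y))\<^sup>2 \<le> 4 * J x + 4 * J y - 8 * m" for x y
  proof -
    have "J ((1/2) *\<^sub>R (x + y)) = (norm (x + y))\<^sup>2 / 8 - (g x + g y) / 2"
      unfolding J_def norm_scaleR g.scaleR g.add by (simp add: power_divide)
    with m_le[of "(1/2) *\<^sub>R (x + y)"] have "m \<le> (norm (x + y))\<^sup>2 / 8 - (g x + g y) / 2"
      by simp
    then show ?thesis
      using norm_add_sqr[of x y] norm_diff_sqr[of x y] by (simp add: J_def field_simps)
  qed
  have "Cauchy X"
  proof (rule CauchyI)
    fix e :: real assume e: "0 < e"
    obtain N where N: "1 / real (Suc N) < e\<^sup>2 / 8"
      using reals_Archimedean[of "e\<^sup>2 / 8"] e by (auto simp: inverse_eq_divide)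
    have *: "J (X n) - m < e\<^sup>2 / 8" if "n \<ge> N" for n
    proof -
      have "1 / real (Suc n) \<le> 1 / real (Suc N)"
        using that by (intro divide_left_mono) auto
      with X[of n] N show ?thesis by linarith
    qed
    have "norm (X i - X j) < e" if "i \<ge> N" "j \<ge> N" for i j
    proof -
      have "(norm (X i - X j))\<^sup>2 < e\<^sup>2"
        using par[of "X i" "X j"] *[OF that(1)] *[OF that(2)] by linarith
      then show ?thesis
        by (rule power2_less_imp_less) (use e in simp)
    qed
    then show "\<exists>M. \<forall>i\<ge>M. \<forall>j\<ge>M. norm (X i - X j) < e" by blast
  qed
  then obtain z where z: "X \<longlonglongrightarrow> z"
    using Cauchy_convergent_iff convergent_def by blast
  have "(\<lambda>n. J (X n)) \<longlonglongrightarrow> J z"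
    unfolding J_def by (intro tendsto_intros z g.tendsto) simp
  moreover have "(\<lambda>n. J (X n)) \<longlonglongrightarrow> m"
  proof (rule tendsto_sandwich)
    show "\<forall>\<^sub>F n in sequentially. m \<le> J (X n)"
      using m_le by simp
    show "\<forall>\<^sub>F n in sequentially. J (X n) \<le> m + 1 / Suc n"
      using X by (simp add: less_imp_le)
    show "(\<lambda>n. m + 1 / real (Suc n)) \<longlonglongrightarrow> m"
      using tendsto_add[OF tendsto_const[of m] LIMSEQ_inverse_real_of_nat]
      by (simp add: inverse_eq_divide)
  qed simp
  ultimately have Jz: "J z = m"
    using LIMSEQ_unique by blast
  have "g x = Re (cinner x z)" for x
  proof -
    define d where "d = Re (cinner x z) - g x"
    have main: "0 \<le> t * d + t\<^sup>2 * (norm x)\<^sup>2 / 2" for t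
    proof -
      have "J (z + t *\<^sub>R x) = J z + t * d + t\<^sup>2 * (norm x)\<^sup>2 / 2"
        unfolding J_def norm_add_sqr d_def
        by (simp add: g.add g.scaleR cinner_scaleR_right Re_cinner_commute[of z x]
            power_mult_distrib field_simps)
      with m_le[of "z + t *\<^sub>R x"] Jz show ?thesis by simp
    qed
    have "d = 0"
    proof (rule ccontr)
      assume "d \<noteq> 0"
      define q where "q = (norm x)\<^sup>2 + 1"
      have q: "q > 0" by (simp add: q_def add_nonneg_pos)
      have "0 \<le> (- d / q) * d + (- d / q)\<^sup>2 * (norm x)\<^sup>2 / 2"
        by (rule main)
      also have "\<dots> \<le> (- d / q) * d + (- d / q)\<^sup>2 * q / 2"
        by (intro add_left_mono divide_right_mono mult_left_mono) (auto simp: q_def)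
      also have "\<dots> = - (d\<^sup>2 / q) / 2"
        using q by (simp add: field_simps power2_eq_square)
      also have "\<dots> < 0"
        using q \<open>d \<noteq> 0\<close> by simp
      finally show False by simp
    qed
    then show ?thesis by (simp add: d_def)
  qed
  then show ?thesis by blast
qed

lemma riesz:
  fixes f :: "'a::complex_hilbert_space \<Rightarrow> complex"
  assumes "bounded_linear f" and lin: "\<And>c x. f (c *\<^sub>C x) = c * f x"
  shows "\<exists>z. \<forall>x. f x = cinner x z"
proof -
  have "bounded_linear (\<lambda>x. Re (f x))"
    by (rule bounded_linear_compose[OF bounded_linear_Re assms(1)])
  then obtain z where z: "\<And>x. Re (f x) = Re (cinner x z)"
    using riesz_real by blast
  have "f x = cinner x z" for x
    using z[of x] z[of "\<i> *\<^sub>C x"] by (simp add: lin cinner_scaleC_left complex_eq_iff)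
  then show ?thesis by blast
qed


section \<open>The C*-algebra of bounded operators on a Hilbert space\<close>

typedef (overloaded) ('h::complex_hilbert_space) bop =
  "{T :: 'h \<Rightarrow>\<^sub>L 'h. \<forall>c x. blinfun_apply T (c *\<^sub>C x) = c *\<^sub>C blinfun_apply T x}"
  morphisms blinfun_of_bop Bop
  by (rule exI[of _ id_blinfun]) simp

setup_lifting type_definition_bop

lift_definition bop_apply :: "'h::complex_hilbert_space bop \<Rightarrow> 'h \<Rightarrow> 'h" is blinfun_apply .

instantiation bop :: (complex_hilbert_space) real_normed_vector
begin

lift_definition zero_bop :: "'a bop" is 0
  by simp

lift_definition plus_bop :: "'a bop \<Rightarrow> 'a bop \<Rightarrow> 'a bop" is "(+)"
  by (simp add: blinfun.add_left scaleC_add_right)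

lift_definition minus_bop :: "'a bop \<Rightarrow> 'a bop \<Rightarrow> 'a bop" is "(-)"
  by (simp add: blinfun.diff_left scaleC_diff_right)

lift_definition uminus_bop :: "'a bop \<Rightarrow> 'a bop" is uminus
  by (simp add: blinfun.minus_left scaleC_minus_right)

lift_definition scaleR_bop :: "real \<Rightarrow> 'a bop \<Rightarrow> 'a bop" is scaleR
  by (simp add: blinfun.scaleR_left scaleR_scaleC scaleC_scaleC mult.commute)

lift_definition norm_bop :: "'a bop \<Rightarrow> real" is norm .

definition dist_bop :: "'a bop \<Rightarrow> 'a bop \<Rightarrow> real"
  where "dist_bop S T = norm (S - T)"

definition sgn_bop :: "'a bop \<Rightarrow> 'a bop"
  where "sgn_bop T = scaleR (inverse (norm T)) T"

definition uniformity_bop :: "('a bop \<times> 'a bop) filter"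
  where "uniformity_bop = (INF e\<in>{0 <..}. principal {(x, y). dist x y < e})"

definition open_bop :: "'a bop set \<Rightarrow> bool"
  where "open_bop U = (\<forall>x\<in>U. \<forall>\<^sub>F (x', y) in uniformity. x' = x \<longrightarrow> y \<in> U)"

instance
proof
  fix a b :: real and x y z :: "'a bop"
  show "x + y + z = x + (y + z)" by transfer (simp add: add.assoc)
  show "x + y = y + x" by transfer (simp add: add.commute)
  show "0 + x = x" by transfer simp
  show "- x + x = 0" by transfer simp
  show "x - y = x + - y" by transfer simp
  show "a *\<^sub>R (x + y) = a *\<^sub>R x + a *\<^sub>R y" by transfer (simp add: scaleR_add_right)
  show "(a + b) *\<^sub>R x = a *\<^sub>R x + b *\<^sub>R x" by transfer (simp add: scaleR_add_left)
  show "a *\<^sub>R b *\<^sub>R x = (a * b) *\<^sub>R x" by transfer simp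
  show "1 *\<^sub>R x = x" by transfer simp
  show "dist x y = norm (x - y)" by (rule dist_bop_def)
  show "sgn x = scaleR (inverse (norm x)) x" by (simp add: sgn_bop_def)
  show "(uniformity :: ('a bop \<times> 'a bop) filter) = (INF e\<in>{0 <..}. principal {(x, y). dist x y < e})"
    by (rule uniformity_bop_def)
  show "open U = (\<forall>x\<in>U. \<forall>\<^sub>F (x', y) in uniformity. x' = x \<longrightarrow> y \<in> U)" for U :: "'a bop set"
    by (rule open_bop_def)
  show "norm x = 0 \<longleftrightarrow> x = 0" by transfer simp
  show "norm (x + y) \<le> norm x + norm y" by transfer (rule norm_triangle_ineq)
  show "norm (a *\<^sub>R x) = \<bar>a\<bar> * norm x" by transfer simp
qed

end

instantiation bop :: (complex_hilbert_space) complex_normed_space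
begin

lift_definition scaleC_bop :: "complex \<Rightarrow> 'a bop \<Rightarrow> 'a bop" is
  "\<lambda>c T. Blinfun (\<lambda>x. c *\<^sub>C blinfun_apply T x)"
  by (simp add: bounded_linear_Blinfun_apply scaleC_scaleC mult.commute
      bounded_linear_compose[OF bounded_linear_scaleC_right blinfun.bounded_linear_right])

lemma blinfun_apply_scaleC_bop:
  "blinfun_apply (blinfun_of_bop (c *\<^sub>C T)) x = c *\<^sub>C blinfun_apply (blinfun_of_bop (T::'a bop)) x"
  by (simp add: scaleC_bop.rep_eq bounded_linear_Blinfun_apply
      bounded_linear_compose[OF bounded_linear_scaleC_right blinfun.bounded_linear_right])

instance
proof
  fix a :: real and c d :: complex and x y z :: "'a bop"
  note ext = blinfun_of_bop_inject[THEN iffD1, OF blinfun_eqI]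
  show "c *\<^sub>C (x + y) = c *\<^sub>C x + c *\<^sub>C y"
    by (rule ext) (simp add: blinfun_apply_scaleC_bop plus_bop.rep_eq blinfun.add_left scaleC_add_right)
  show "(c + d) *\<^sub>C x = c *\<^sub>C x + d *\<^sub>C x"
    by (rule ext) (simp add: blinfun_apply_scaleC_bop plus_bop.rep_eq blinfun.add_left scaleC_add_left)
  show "c *\<^sub>C d *\<^sub>C x = (c * d) *\<^sub>C x"
    by (rule ext) (simp add: blinfun_apply_scaleC_bop scaleC_scaleC)
  show "a *\<^sub>R x = complex_of_real a *\<^sub>C x"
    by (rule ext)
       (simp add: blinfun_apply_scaleC_bop scaleR_bop.rep_eq blinfun.scaleR_left scaleR_scaleC)
  have le: "norm (c *\<^sub>C x) \<le> cmod c * norm x" for c and x :: "'a bop"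
    unfolding norm_bop.rep_eq
  proof (rule norm_blinfun_bound)
    fix v :: 'a
    show "norm (blinfun_apply (blinfun_of_bop (c *\<^sub>C x)) v)
        \<le> cmod c * norm (blinfun_of_bop x) * norm v"
      unfolding blinfun_apply_scaleC_bop norm_scaleC mult.assoc
      by (intro mult_left_mono norm_blinfun) simp
  qed simp
  show "norm (c *\<^sub>C x) = cmod c * norm x"
  proof (cases "c = 0")
    case True
    have "norm (c *\<^sub>C x) \<ge> 0" unfolding norm_bop.rep_eq by simp
    with le[of c x] True show ?thesis by simp
  next
    case False
    have "inverse c *\<^sub>C c *\<^sub>C x = x"
      using False by (intro ext) (simp add: blinfun_apply_scaleC_bop scaleC_scaleC)
    with le[of "inverse c" "c *\<^sub>C x"] have "norm x \<le> inverse (cmod c) * norm (c *\<^sub>C x)"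
      by (simp add: norm_inverse)
    then have "cmod c * norm x \<le> norm (c *\<^sub>C x)"
      using False by (simp add: field_simps)
    with le[of c x] show ?thesis by simp
  qed
qed

end

lemma bop_eqI: "(\<And>x. bop_apply S x = bop_apply T x) \<Longrightarrow> S = T"
  by transfer (rule blinfun_eqI)

lemma bop_apply_scaleC_right: "bop_apply T (c *\<^sub>C x) = c *\<^sub>C bop_apply T x"
  by transfer simp

lemma bop_apply_add_right: "bop_apply T (x + y) = bop_apply T x + bop_apply T y"
  by transfer (rule blinfun.add_right)

lemma bop_apply_zero_left [simp]: "bop_apply 0 x = 0"
  by transfer simp

lemma bop_apply_add_left: "bop_apply (S + T) x = bop_apply S x + bop_apply T x"
  by transfer (rule blinfun.add_left)

lemma bop_apply_diff_left: "bop_apply (S - T) x = bop_apply S x - bop_apply T x"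
  by transfer (rule blinfun.diff_left)

lemma bop_apply_scaleR_left: "bop_apply (r *\<^sub>R T) x = r *\<^sub>R bop_apply T x"
  by transfer (rule blinfun.scaleR_left)

lemma bop_apply_scaleC_left: "bop_apply (c *\<^sub>C T) x = c *\<^sub>C bop_apply T x"
  by (simp add: bop_apply.rep_eq blinfun_apply_scaleC_bop)

lemma norm_bop_apply_le: "norm (bop_apply T x) \<le> norm T * norm x"
  by transfer (rule norm_blinfun)

lemma norm_bop_le: "0 \<le> b \<Longrightarrow> (\<And>x. norm (bop_apply T x) \<le> b * norm x) \<Longrightarrow> norm T \<le> b"
  by transfer (rule norm_blinfun_bound)

lemma bounded_linear_bop_apply: "bounded_linear (bop_apply T)"
  by transfer (rule blinfun.bounded_linear_right)

lemma norm_bop_eq_onorm: "norm T = onorm (bop_apply T)"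
  by transfer (simp add: norm_blinfun.rep_eq)

lemma ex_bop:
  assumes "bounded_linear f" "\<And>c x. f (c *\<^sub>C x) = c *\<^sub>C f x"
  shows "\<exists>T. bop_apply T = f"
proof -
  have "bop_apply (Bop (Blinfun f)) = f"
    unfolding bop_apply.rep_eq
    using assms by (subst Bop_inverse) (auto simp: bounded_linear_Blinfun_apply)
  then show ?thesis by blast
qed

instance bop :: (complex_hilbert_space) banach
proof
  fix X :: "nat \<Rightarrow> 'a bop"
  assume "Cauchy X"
  then have "Cauchy (\<lambda>n. blinfun_of_bop (X n))"
    by (simp add: Cauchy_def dist_norm norm_bop.rep_eq minus_bop.rep_eq)
  then obtain L where L: "(\<lambda>n. blinfun_of_bop (X n)) \<longlonglongrightarrow> L"
    using Cauchy_convergent_iff convergent_def by blast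
  have pt: "(\<lambda>n. bop_apply (X n) x) \<longlonglongrightarrow> blinfun_apply L x" for x
    unfolding bop_apply.rep_eq
    by (rule bounded_linear.tendsto[OF blinfun.bounded_linear_left L])
  have "blinfun_apply L (c *\<^sub>C x) = c *\<^sub>C blinfun_apply L x" for c x
  proof (rule LIMSEQ_unique)
    show "(\<lambda>n. bop_apply (X n) (c *\<^sub>C x)) \<longlonglongrightarrow> blinfun_apply L (c *\<^sub>C x)"
      by (rule pt)
    show "(\<lambda>n. bop_apply (X n) (c *\<^sub>C x)) \<longlonglongrightarrow> c *\<^sub>C blinfun_apply L x"
      unfolding bop_apply_scaleC_right
      by (rule bounded_linear.tendsto[OF bounded_linear_scaleC_right pt])
  qed
  then have "blinfun_of_bop (Bop L) = L"
    by (simp add: Bop_inverse)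
  with L have "X \<longlonglongrightarrow> Bop L"
    by (simp add: LIMSEQ_iff norm_bop.rep_eq minus_bop.rep_eq)
  then show "convergent X"
    by (rule convergentI)
qed

lemma ex1_adjoint:
  fixes T :: "'h::complex_hilbert_space bop"
  shows "\<exists>!S. \<forall>x y. cinner (bop_apply T x) y = cinner x (bop_apply S y)"
proof -
  have "\<exists>z. \<forall>x. cinner (bop_apply T x) y = cinner x z" for y
  proof (rule riesz)
    show "bounded_linear (\<lambda>x. cinner (bop_apply T x) y)"
    proof (rule bounded_linear_intro[where K = "norm T * norm y"])
      fix x
      have "cmod (cinner (bop_apply T x) y) \<le> norm (bop_apply T x) * norm y"
        by (rule cmod_cinner_le)
      also have "\<dots> \<le> (norm T * norm x) * norm y"
        by (intro mult_right_mono norm_bop_apply_le) simp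
      finally show "norm (cinner (bop_apply T x) y) \<le> norm x * (norm T * norm y)"
        by (simp add: mult_ac)
    qed (simp_all add: bop_apply_add_right cinner_add_left scaleR_scaleC bop_apply_scaleC_right
        cinner_scaleC_left scaleR_conv_of_real)
  qed (simp add: bop_apply_scaleC_right cinner_scaleC_left)
  then obtain s where s: "\<And>x y. cinner (bop_apply T x) y = cinner x (s y)"
    by metis
  have sC: "s (c *\<^sub>C y) = c *\<^sub>C s y" for c y
    by (rule cinner_eqI) (simp add: s[symmetric] cinner_scaleC_right)
  have "bounded_linear s"
  proof (rule bounded_linear_intro[where K = "norm T"])
    fix x y and r :: real
    show "s (x + y) = s x + s y"
      by (rule cinner_eqI) (simp add: s[symmetric] cinner_add_right)
    show "s (r *\<^sub>R x) = r *\<^sub>R s x"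
      by (simp add: scaleR_scaleC sC)
    have "(norm (s x))\<^sup>2 = cmod (cinner (bop_apply T (s x)) x)"
      unfolding s cinner_self by (simp add: norm_power)
    also have "\<dots> \<le> norm (bop_apply T (s x)) * norm x"
      by (rule cmod_cinner_le)
    also have "\<dots> \<le> (norm T * norm (s x)) * norm x"
      by (intro mult_right_mono norm_bop_apply_le) simp
    finally have "norm (s x) * norm (s x) \<le> norm (s x) * (norm x * norm T)"
      by (simp add: power2_eq_square mult_ac)
    then show "norm (s x) \<le> norm x * norm T"
      by (cases "s x = 0") simp_all
  qed
  then obtain S where "bop_apply S = s"
    using ex_bop sC by blast
  with s have ex: "\<forall>x y. cinner (bop_apply T x) y = cinner x (bop_apply S y)"
    by simp
  show ?thesis
  proof (rule ex1I[of _ S])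
    fix S' assume "\<forall>x y. cinner (bop_apply T x) y = cinner x (bop_apply S' y)"
    with ex show "S' = S"
      by (intro bop_eqI cinner_eqI) simp
  qed (fact ex)
qed

instantiation bop :: (complex_hilbert_space) unital_cstar_algebra
begin

lift_definition one_bop :: "'a bop" is id_blinfun by simp

lift_definition times_bop :: "'a bop \<Rightarrow> 'a bop \<Rightarrow> 'a bop" is blinfun_compose by simp

definition star_bop :: "'a bop \<Rightarrow> 'a bop" where
  "star_bop T = (THE S. \<forall>x y. cinner (bop_apply T x) y = cinner x (bop_apply S y))"

lemma bop_apply_one: "bop_apply (1 :: 'a bop) x = x"
  by transfer simp

lemma bop_apply_mult: "bop_apply (S * T :: 'a bop) x = bop_apply S (bop_apply T x)"
  by transfer simp

lemma cinner_star_right: "cinner x (bop_apply (star T) y) = cinner (bop_apply (T :: 'a bop) x) y"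
  using theI'[OF ex1_adjoint[of T]] unfolding star_bop_def[symmetric] by metis

lemma star_bop_eqI:
  "(\<And>x y. cinner (bop_apply T x) y = cinner x (bop_apply S y)) \<Longrightarrow> star T = (S :: 'a bop)"
  by (rule bop_eqI, rule cinner_eqI) (simp add: cinner_star_right)

lemma cinner_star_left: "cinner (bop_apply (star T) x) y = cinner x (bop_apply (T :: 'a bop) y)"
  by (subst (1 2) cinner_commute) (simp add: cinner_star_right)

instance
proof
  fix c :: complex and r :: real and x y z :: "'a bop"
  show "x * y * z = x * (y * z)" by (rule bop_eqI) (simp add: bop_apply_mult)
  show "(x + y) * z = x * z + y * z"
    by (rule bop_eqI) (simp add: bop_apply_mult bop_apply_add_left)
  show "x * (y + z) = x * y + x * z"
    by (rule bop_eqI) (simp add: bop_apply_mult bop_apply_add_left bop_apply_add_right)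
  show "1 * x = x" "x * 1 = x"
    by (rule bop_eqI, simp add: bop_apply_mult bop_apply_one)+
  show L: "(c *\<^sub>C x) * y = c *\<^sub>C (x * y)" for c
    by (rule bop_eqI) (simp add: bop_apply_mult bop_apply_scaleC_left)
  show R: "x * (c *\<^sub>C y) = c *\<^sub>C (x * y)" for c
    by (rule bop_eqI) (simp add: bop_apply_mult bop_apply_scaleC_left bop_apply_scaleC_right)
  show "r *\<^sub>R x * y = r *\<^sub>R (x * y)" "x * r *\<^sub>R y = r *\<^sub>R (x * y)"
    by (simp_all add: scaleR_scaleC L R)
  show mult: "norm (x * y) \<le> norm x * norm y" for x y :: "'a bop"
    by transfer (rule norm_blinfun_compose)
  show "star (x + y) = star x + star y"
    by (rule star_bop_eqI)
       (simp add: bop_apply_add_left cinner_add_left cinner_add_right cinner_star_right)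
  show "star (c *\<^sub>C x) = cnj c *\<^sub>C star x"
    by (rule star_bop_eqI)
       (simp add: bop_apply_scaleC_left cinner_scaleC_left cinner_scaleC_right cinner_star_right)
  show "star (x * y) = star y * star x"
    by (rule star_bop_eqI) (simp add: bop_apply_mult cinner_star_right)
  show ss: "star (star x) = x" for x :: "'a bop"
    by (rule star_bop_eqI) (simp add: cinner_star_left)
  have sq: "(norm x)\<^sup>2 \<le> norm (star x * x)" for x :: "'a bop"
  proof -
    have "norm x \<le> sqrt (norm (star x * x))"
    proof (rule norm_bop_le)
      fix v
      have "(norm (bop_apply x v))\<^sup>2 = cmod (cinner (bop_apply x v) (bop_apply x v))"
        unfolding cinner_self by (simp add: norm_power)
      also have "\<dots> = cmod (cinner v (bop_apply (star x * x) v))"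
        by (simp add: bop_apply_mult cinner_star_right)
      also have "\<dots> \<le> norm v * norm (bop_apply (star x * x) v)"
        by (rule cmod_cinner_le)
      also have "\<dots> \<le> norm v * (norm (star x * x) * norm v)"
        by (intro mult_left_mono norm_bop_apply_le) simp
      also have "\<dots> = (sqrt (norm (star x * x)) * norm v)\<^sup>2"
        by (simp add: power_mult_distrib) (simp add: power2_eq_square)
      finally show "norm (bop_apply x v) \<le> sqrt (norm (star x * x)) * norm v"
        by (rule power2_le_imp_le) simp
    qed simp
    then have "(norm x)\<^sup>2 \<le> (sqrt (norm (star x * x)))\<^sup>2"
      by (rule power_mono) simp
    then show ?thesis by simp
  qed
  have le: "norm x \<le> norm (star x)" for x :: "'a bop"
  proof (cases "x = 0")
    case False
    have "norm x * norm x \<le> norm (star x) * norm x"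
      using sq[of x] mult[of "star x" x] by (simp add: power2_eq_square)
    with False show ?thesis by simp
  qed simp
  have "norm (star x) = norm x"
    using le[of x] le[of "star x"] by (simp add: ss)
  with mult[of "star x" x] sq[of x] show "norm (star x * x) = (norm x)\<^sup>2"
    by (simp add: power2_eq_square)
qed

end

end

theory Submission
  imports Defs "HOL-Computational_Algebra.Fundamental_Theorem_Algebra"
begin

text \<open>
  Put \<open>X = \<phi>(a\<^sup>r)\<close> and \<open>Y = \<phi>(a\<^sup>s)\<close>.  Jensen's inequality for the operator concave function with
  exponent \<open>r/s \<le> 1\<close> gives \<open>X \<le> Y\<^sup>r\<^sup>/\<^sup>s\<close>, and operator monotonicity of the power with exponent
  \<open>1/r \<le> 1\<close> then gives \<open>X\<^sup>1\<^sup>/\<^sup>r \<le> Y\<^sup>1\<^sup>/\<^sup>s\<close>.  Both steps are instances of \<open>positive_map_powr_le\<close>: if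
  \<open>\<phi>(f(a)) \<le> g(Y)\<close> and \<open>0 < \<alpha> \<le> 1\<close>, then \<open>\<phi>(f\<^sup>\<alpha>(a)) \<le> g\<^sup>\<alpha>(Y)\<close>, where \<open>\<phi>\<close> is a positive contraction, for
  instance the identity.

  The case \<open>\<alpha> < 1\<close> reduces to the functions \<open>x / (x + l)\<close> with \<open>l > 0\<close>, since on bounded intervals
  \<open>x\<^sup>\<alpha>\<close> is a uniform limit of nonnegative combinations of them (\<open>powr_resolvent_approx\<close>).  For these
  functions there is a variational principle: for a positive operator \<open>Z\<close> the quadratic form of
  \<open>Z / (Z + l)\<close> at \<open>v\<close> is the minimum over \<open>w\<close> of \<open>\<langle>Z w, w\<rangle> / l + |v - w|\<^sup>2\<close>.  The minimum is attained
  (\<open>rfc_resolvent_attained\<close>), and the lower bound persists under \<open>\<phi>\<close> (\<open>bform_resolvent_le\<close>): it needs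
  positivity of \<open>\<phi>\<close> only on the commutative algebra generated by \<open>a\<close>, where a partition of unity
  reduces it to the scalar inequality.  Contractivity of \<open>\<phi>\<close> enters through \<open>\<phi>(1) \<le> 1\<close>.

  The operations on \<open>a\<close> rest on the continuous functional calculus of a self-adjoint element
  (\<open>is_functional_calculus_poly_limit\<close>, \<open>functional_calculus_eq\<close>).  It is the limit of the polynomial
  calculus, by the theorem of Weierstrass and the estimate of the norm of a self-adjoint element by its
  spectral radius (\<open>norm_selfadjoint_le\<close>).  The latter is derived from convergence of the binomial
  series of \<open>sqrt (1 - x)\<close> for \<open>norm x \<le> 1\<close>.
\<close>


section \<open>Invertible elements and the spectrum\<close>

lemma scaleC_zero_left [simp]: "0 *\<^sub>C (x::'a::complex_normed_space) = 0"
  by (metis of_real_0 scaleR_scaleC scaleR_zero_left)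

lemma scaleC_minus_left: "(- c) *\<^sub>C (x::'a::complex_normed_space) = - (c *\<^sub>C x)"
  by (metis add.right_inverse add_eq_0_iff scaleC_add_left scaleC_zero_left)

lemma scaleC_diff_left: "(c - d) *\<^sub>C (x::'a::complex_normed_space) = c *\<^sub>C x - d *\<^sub>C x"
  using scaleC_add_left[of c "- d" x] by (simp add: scaleC_minus_left)

lemma star_zero [simp]: "star 0 = (0::'a::unital_cstar_algebra)"
  by (metis add_cancel_right_right star_add)

lemma star_minus: "star (- x) = - star (x::'a::unital_cstar_algebra)"
  by (metis add.right_inverse add_eq_0_iff star_add star_zero)

lemma star_diff: "star (x - y) = star x - star (y::'a::unital_cstar_algebra)"
  using star_add[of x "- y"] by (simp add: star_minus)

lemma star_one [simp]: "star 1 = (1::'a::unital_cstar_algebra)"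
  by (metis mult.left_neutral mult.right_neutral star_mult star_star)

lemma star_scaleR: "star (r *\<^sub>R x) = r *\<^sub>R star (x::'a::unital_cstar_algebra)"
  by (simp add: scaleR_scaleC star_scaleC)

lemma star_power: "star (x ^ n) = star (x::'a::unital_cstar_algebra) ^ n"
  by (induction n) (simp_all add: star_mult power_commutes)

lemma norm_star: "norm (star x) = norm (x::'a::unital_cstar_algebra)"
proof -
  have le: "norm y \<le> norm (star y)" for y :: 'a
  proof (cases "y = 0")
    case False
    have "norm y * norm y \<le> norm (star y) * norm y"
      using norm_star_mult_self[of y] norm_mult_ineq[of "star y" y] by (simp add: power2_eq_square)
    with False show ?thesis by simp
  qed simp
  show ?thesis
    using le[of x] le[of "star x"] by (simp add: star_star)
qed

lemma bounded_linear_star: "bounded_linear (star :: 'a \<Rightarrow> 'a::unital_cstar_algebra)"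
  by (rule bounded_linear_intro[where K = 1]) (simp_all add: star_add star_scaleR norm_star)

text \<open>In the zero algebra the norm of the unit is \<open>0\<close>.\<close>

lemma norm_one_le: "norm (1::'a::unital_cstar_algebra) \<le> 1"
proof -
  have "norm (1::'a) * norm (1::'a) = norm (1::'a)"
    using norm_star_mult_self[of "1::'a"] by (simp add: power2_eq_square)
  then show ?thesis
    by (cases "norm (1::'a) = 0") simp_all
qed

lemma norm_power_le: "norm (x ^ n) \<le> norm (x::'a::unital_cstar_algebra) ^ n"
proof (induction n)
  case (Suc n)
  have "norm (x * x ^ n) \<le> norm x * norm (x ^ n)" by (rule norm_mult_ineq)
  also have "\<dots> \<le> norm x * norm x ^ n" using Suc by (intro mult_left_mono) simp_all
  finally show ?case by simp
qed (simp add: norm_one_le)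

text \<open>Two-sided invertibility; in the zero algebra \<open>0\<close> is invertible.\<close>

definition invertible_element :: "'a::unital_cstar_algebra \<Rightarrow> bool" where
  "invertible_element x \<longleftrightarrow> (\<exists>y. y * x = 1 \<and> x * y = 1)"

lemma spectrum_iff: "z \<in> spectrum a \<longleftrightarrow> \<not> invertible_element (a - z *\<^sub>C 1)"
  by (simp add: spectrum_def invertible_element_def)

lemma invertible_element_mult:
  assumes "invertible_element x" "invertible_element y"
  shows "invertible_element (x * y)"
proof -
  obtain u v where "u * x = 1" "x * u = 1" "v * y = 1" "y * v = 1"
    using assms by (auto simp: invertible_element_def)
  then have "(v * u) * (x * y) = 1" "(x * y) * (v * u) = 1"
    by (metis mult.assoc mult.right_neutral)+
  then show ?thesis by (auto simp: invertible_element_def)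
qed

lemma invertible_element_scaleC:
  assumes "invertible_element x" "c \<noteq> 0"
  shows "invertible_element (c *\<^sub>C x)"
proof -
  obtain u where "u * x = 1" "x * u = 1"
    using assms by (auto simp: invertible_element_def)
  then have "(inverse c *\<^sub>C u) * (c *\<^sub>C x) = 1" "(c *\<^sub>C x) * (inverse c *\<^sub>C u) = 1"
    using assms(2) by (simp_all add: mult_scaleC_left mult_scaleC_right scaleC_scaleC)
  then show ?thesis by (auto simp: invertible_element_def)
qed

lemma invertible_element_one: "invertible_element 1"
  by (auto simp: invertible_element_def)

lemma invertible_element_one_minus:
  fixes x :: "'a::unital_cstar_algebra"
  assumes "norm x < 1"
  shows "invertible_element (1 - x)"
proof -
  have sm: "summable (\<lambda>n. x ^ n)"
    by (rule summable_comparison_test'[where g = "\<lambda>n. norm x ^ n" and N = 0])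
       (use assms in \<open>simp_all add: norm_power_le\<close>)
  define s where "s = (\<Sum>n. x ^ n)"
  have "s = 1 + (\<Sum>n. x ^ Suc n)"
    using suminf_split_head[OF sm] by (simp add: s_def)
  moreover have "(\<Sum>n. x ^ Suc n) = x * s"
    using suminf_mult[OF sm, of x] by (simp add: s_def)
  moreover have "(\<Sum>n. x ^ Suc n) = s * x"
    using suminf_mult2[OF sm, of x] by (simp add: s_def power_commutes)
  ultimately have "s * (1 - x) = 1" "(1 - x) * s = 1"
    by (simp_all add: algebra_simps)
  then show ?thesis by (auto simp: invertible_element_def)
qed

lemma spectrum_bound:
  fixes a :: "'a::unital_cstar_algebra"
  assumes "z \<in> spectrum a"
  shows "cmod z \<le> norm a"
proof (rule ccontr)
  assume "\<not> ?thesis"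
  then have z: "norm a < cmod z" by simp
  then have z0: "z \<noteq> 0" by auto
  have "norm (inverse z *\<^sub>C a) < 1"
    using z z0 by (simp add: norm_scaleC norm_inverse divide_inverse[symmetric] mult.commute[of "inverse _"])
  then have "invertible_element ((- z) *\<^sub>C (1 - inverse z *\<^sub>C a))"
    using z0 by (intro invertible_element_scaleC invertible_element_one_minus) simp_all
  also have "(- z) *\<^sub>C (1 - inverse z *\<^sub>C a) = a - z *\<^sub>C 1"
    using z0 by (simp add: scaleC_diff_right scaleC_scaleC scaleC_minus_left)
  finally show False using assms by (simp add: spectrum_iff)
qed

lemma compact_spectrum: "compact (spectrum (a::'a::unital_cstar_algebra))"
proof -
  have "open (- spectrum a)"
    unfolding open_dist
  proof
    fix z assume "z \<in> - spectrum a"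
    then obtain g where g: "g * (a - z *\<^sub>C 1) = 1" "(a - z *\<^sub>C 1) * g = 1"
      by (auto simp: spectrum_def)
    have inv: "invertible_element (a - z *\<^sub>C 1)"
      using g by (auto simp: invertible_element_def)
    show "\<exists>e>0. \<forall>w. dist w z < e \<longrightarrow> w \<in> - spectrum a"
    proof (intro exI[of _ "1 / (norm g + 1)"] conjI allI impI)
      fix w assume w: "dist w z < 1 / (norm g + 1)"
      have "norm ((w - z) *\<^sub>C g) \<le> dist w z * (norm g + 1)"
        by (simp add: norm_scaleC dist_norm mult_left_mono)
      also have "\<dots> < 1"
        using w by (simp only: pos_less_divide_eq add_nonneg_pos norm_ge_zero zero_less_one)
      finally have "invertible_element ((a - z *\<^sub>C 1) * (1 - (w - z) *\<^sub>C g))"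
        by (intro invertible_element_mult inv invertible_element_one_minus)
      also have "(a - z *\<^sub>C 1) * (1 - (w - z) *\<^sub>C g) = a - w *\<^sub>C 1"
        by (simp only: right_diff_distrib mult_scaleC_right g) (simp add: scaleC_diff_left)
      finally show "w \<in> - spectrum a" by (simp add: spectrum_iff)
    qed (simp add: add_nonneg_pos)
  qed
  moreover have "bounded (spectrum a)"
    using spectrum_bound by (auto simp: bounded_iff)
  ultimately show ?thesis
    by (simp add: compact_eq_bounded_closed closed_def)
qed

text \<open>
  A translation by \<open>\<i>t\<close> with suitable real \<open>t\<close> moves a spectral point \<open>z\<close> with \<open>Im z \<noteq> 0\<close> out of
  the disc of radius \<open>norm (a + \<i>t)\<close>, as the square of this norm is at most \<open>(norm a)\<^sup>2 + t\<^sup>2\<close>.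
\<close>

lemma spectrum_selfadjoint_real:
  fixes a :: "'a::unital_cstar_algebra"
  assumes sa: "star a = a" and z: "z \<in> spectrum a"
  shows "Im z = 0"
proof (rule ccontr)
  assume nz: "Im z \<noteq> 0"
  have bound: "(cmod (z + \<i> * of_real t))\<^sup>2 \<le> (norm a)\<^sup>2 + t\<^sup>2" for t
  proof -
    define b where "b = a + (\<i> * of_real t) *\<^sub>C 1"
    have "b - (z + \<i> * of_real t) *\<^sub>C 1 = a - z *\<^sub>C 1"
      by (simp add: b_def scaleC_add_left)
    then have "z + \<i> * of_real t \<in> spectrum b"
      using z by (simp add: spectrum_iff)
    then have "(cmod (z + \<i> * of_real t))\<^sup>2 \<le> (norm b)\<^sup>2"
      by (intro power_mono spectrum_bound) simp_all
    also have "(norm b)\<^sup>2 = norm (star b * b)"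
      by (simp add: norm_star_mult_self)
    also have "star b * b = a * a + (t\<^sup>2) *\<^sub>R 1"
      by (simp add: b_def star_add star_scaleC sa algebra_simps mult_scaleC_left mult_scaleC_right
          scaleC_scaleC scaleC_minus_left scaleC_diff_right scaleR_scaleC power2_eq_square)
    also have "norm \<dots> \<le> norm (a * a) + t\<^sup>2 * norm (1::'a)"
      using norm_triangle_ineq[of "a * a" "(t\<^sup>2) *\<^sub>R (1::'a)"] by simp
    also have "\<dots> \<le> (norm a)\<^sup>2 + t\<^sup>2"
      using norm_mult_ineq[of a a] norm_one_le[where 'a = 'a]
        mult_left_mono[of "norm (1::'a)" 1 "t\<^sup>2"]
      by (simp add: power2_eq_square)
    finally show ?thesis .
  qed
  define t where "t = ((norm a)\<^sup>2 + 1) / (2 * Im z)"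
  have "(Re z)\<^sup>2 + (Im z)\<^sup>2 + 2 * Im z * t \<le> (norm a)\<^sup>2"
    using bound[of t] by (simp add: cmod_power2 power2_sum)
  moreover have "2 * Im z * t = (norm a)\<^sup>2 + 1"
    using nz by (simp add: t_def)
  moreover have "0 \<le> (Re z)\<^sup>2" "0 \<le> (Im z)\<^sup>2" by simp_all
  ultimately show False by linarith
qed


section \<open>Square roots and the norm of self-adjoint elements\<close>

text \<open>The coefficients of the binomial series of \<open>sqrt (1 - x)\<close>; all but the first are \<open>\<le> 0\<close>.\<close>

definition sqrt_coeff :: "nat \<Rightarrow> real" where
  "sqrt_coeff n = ((1/2) gchoose n) * (- 1) ^ n"

lemma sum_sqrt_coeff_nonneg: "0 \<le> (\<Sum>k\<le>n. sqrt_coeff k)"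
proof -
  have "(\<Sum>k\<le>n. sqrt_coeff k) = (- 1) ^ n * ((1/2 - 1 :: real) gchoose n)"
    unfolding sqrt_coeff_def by (rule gbinomial_sum_lower_neg)
  also have "\<dots> = pochhammer (1/2) n / fact n"
    by (simp add: gbinomial_pochhammer flip: power_mult_distrib)
  also have "\<dots> \<ge> 0" by (simp add: pochhammer_nonneg)
  finally show ?thesis .
qed

lemma sqrt_coeff_Suc_nonpos: "sqrt_coeff (Suc n) \<le> 0"
proof -
  have "sqrt_coeff (Suc n) = pochhammer (- 1/2) (Suc n) / fact (Suc n)"
    by (simp add: sqrt_coeff_def gbinomial_pochhammer flip: power_mult_distrib)
  also have "pochhammer (- 1/2) (Suc n) = (- 1/2 :: real) * pochhammer (1/2) n"
    by (simp add: pochhammer_rec)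
  also have "(- 1/2 * pochhammer (1/2) n) / fact (Suc n) \<le> (0::real)"
    by (intro divide_nonpos_nonneg) (simp_all add: pochhammer_nonneg)
  finally show ?thesis .
qed

lemma summable_abs_sqrt_coeff: "summable (\<lambda>n. \<bar>sqrt_coeff n\<bar>)"
proof (rule summableI_nonneg_bounded[where x = 2])
  fix n
  have "(\<Sum>k<n. \<bar>sqrt_coeff k\<bar>) \<le> (\<Sum>k\<le>n. \<bar>sqrt_coeff k\<bar>)"
    by (intro sum_mono2) auto
  also have "\<dots> = 2 * sqrt_coeff 0 - (\<Sum>k\<le>n. sqrt_coeff k)"
  proof (induction n)
    case (Suc n)
    then show ?case using sqrt_coeff_Suc_nonpos[of n] by simp
  qed (simp add: sqrt_coeff_def)
  also have "\<dots> \<le> 2"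
    using sum_sqrt_coeff_nonneg[of n] by (simp add: sqrt_coeff_def)
  finally show "(\<Sum>k<n. \<bar>sqrt_coeff k\<bar>) \<le> 2" .
qed simp

lemma sqrt_coeff_convolution:
  "(\<Sum>i\<le>n. sqrt_coeff i * sqrt_coeff (n - i)) = (if n = 0 then 1 else if n = 1 then - 1 else 0)"
proof -
  have "(\<Sum>i\<le>n. sqrt_coeff i * sqrt_coeff (n - i))
      = (\<Sum>i\<le>n. ((1/2) gchoose i) * ((1/2) gchoose (n - i)) * (- 1) ^ n)"
    by (intro sum.cong) (auto simp: sqrt_coeff_def simp flip: power_add)
  also have "\<dots> = ((1/2 + 1/2 :: real) gchoose n) * (- 1) ^ n"
    by (simp only: sum_distrib_right[symmetric] gbinomial_Vandermonde[unfolded atLeast0AtMost])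
  also have "(1/2 + 1/2 :: real) gchoose n = of_nat (1 choose n)"
    by (simp add: binomial_gbinomial)
  finally show ?thesis
    by (cases n; cases "n - 1") auto
qed

text \<open>
  The coefficients are absolutely summable, so the binomial series converges for \<open>norm x \<le> 1\<close>,
  boundary included.
\<close>

lemma ex_selfadjoint_sqrt:
  fixes x :: "'a::unital_cstar_algebra"
  assumes sa: "star x = x" and nx: "norm x \<le> 1"
  shows "\<exists>y. star y = y \<and> y * y = 1 - x \<and> (\<forall>b. b * x = x * b \<longrightarrow> b * y = y * b)"
proof -
  define f where "f n = sqrt_coeff n *\<^sub>R x ^ n" for n
  have smn: "summable (\<lambda>n. norm (f n))"
  proof (rule summable_comparison_test'[OF summable_abs_sqrt_coeff])
    fix n
    have "norm (x ^ n) \<le> 1"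
      using norm_power_le[of x n] power_le_one[of "norm x" n] nx by simp
    then show "norm (norm (f n)) \<le> \<bar>sqrt_coeff n\<bar>"
      by (simp add: f_def mult_left_le)
  qed
  have sm: "summable f"
    using smn by (rule summable_norm_cancel)
  define y where "y = suminf f"
  have "star y = y"
  proof -
    have "star y = (\<Sum>n. star (f n))"
      unfolding y_def by (rule bounded_linear.suminf[OF bounded_linear_star sm])
    also have "(\<lambda>n. star (f n)) = f"
      by (simp add: f_def[abs_def] star_scaleR star_power sa)
    finally show ?thesis by (simp add: y_def)
  qed
  moreover have "y * y = 1 - x"
  proof -
    have "(\<lambda>n. \<Sum>i\<le>n. f i * f (n - i)) sums (y * y)"
      unfolding y_def by (rule Cauchy_product_sums[OF smn smn])
    moreover have "(\<Sum>i\<le>n. f i * f (n - i)) = (if n = 0 then 1 else if n = 1 then - x else 0)" for n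
    proof -
      have "(\<Sum>i\<le>n. f i * f (n - i)) = (\<Sum>i\<le>n. sqrt_coeff i * sqrt_coeff (n - i)) *\<^sub>R x ^ n"
        unfolding scaleR_sum_left
        by (intro sum.cong) (auto simp: f_def mult.commute simp flip: power_add)
      then show ?thesis by (simp add: sqrt_coeff_convolution)
    qed
    moreover have "(\<lambda>n. if n = 0 then 1 else if n = 1 then - x else 0) sums
        (\<Sum>n\<in>{0, 1::nat}. if n = 0 then 1 else if n = 1 then - x else 0)"
      by (rule sums_finite) auto
    ultimately show ?thesis
      using sums_unique2 by fastforce
  qed
  moreover have "b * y = y * b" if "b * x = x * b" for b
  proof -
    have "b * x ^ n = x ^ n * b" for n
      using that by (induction n) (simp_all add: mult.assoc flip: mult.assoc[of b x])
    then show ?thesis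
      unfolding y_def suminf_mult[OF sm, symmetric] suminf_mult2[OF sm]
      by (simp add: f_def)
  qed
  ultimately show ?thesis by blast
qed

text \<open>
  If \<open>1 - b\<^sup>2\<close> has an inverse \<open>g\<close> and \<open>d = 1 / (norm g + 1)\<close>, then both factors of
  \<open>1 - b\<^sup>2 - d = (1 - b\<^sup>2) (1 - d g)\<close> have square roots by the binomial series, so the product is a
  square \<open>v\<^sup>2\<close> of a self-adjoint \<open>v\<close> that commutes with \<open>b\<close>.  From \<open>b\<^sup>2 + v\<^sup>2 = 1 - d\<close> it follows that
  \<open>b + \<i>v\<close> has norm at most \<open>sqrt (1 - d)\<close>, and so does its real part \<open>b\<close>.
\<close>

lemma norm_less_one_selfadjoint:
  fixes b :: "'a::unital_cstar_algebra"
  assumes sa: "star b = b" and nb: "norm b \<le> 1" and inv: "invertible_element (1 - b * b)"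
  shows "norm b < 1"
proof (cases "(1::'a) = 0")
  case True
  then have "b = 0" by (metis mult.right_neutral mult_zero_right)
  then show ?thesis by simp
next
  case False
  obtain g where g: "g * (1 - b * b) = 1" "(1 - b * b) * g = 1"
    using inv by (auto simp: invertible_element_def)
  have comm_g: "x * g = g * x" if "x * (b * b) = (b * b) * x" for x
  proof -
    have "x * (1 - b * b) = (1 - b * b) * x" using that by (simp add: algebra_simps)
    then have "g * (x * (1 - b * b)) * g = g * ((1 - b * b) * x) * g" by simp
    then show ?thesis using g
      by (metis mult.assoc mult.left_neutral mult.right_neutral)
  qed
  have g0: "g \<noteq> 0" using g False by auto
  have "star g = star g * ((1 - b * b) * g)" using g by simp
  also have "\<dots> = star ((1 - b * b) * g) * g"
    by (simp add: star_mult star_diff sa mult.assoc)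
  finally have sg: "star g = g" using g by simp
  have nbb: "norm (b * b) \<le> 1"
    using norm_mult_ineq[of b b] mult_mono[OF nb nb] by simp
  obtain y where y: "star y = y" "y * y = 1 - b * b"
      "\<And>x. x * (b * b) = (b * b) * x \<Longrightarrow> x * y = y * x"
    using ex_selfadjoint_sqrt[OF _ nbb] by (metis sa star_mult)
  define d where "d = 1 / (norm g + 1)"
  have d: "0 < d" "d < 1" using g0 by (simp_all add: d_def add_pos_pos)
  obtain w where w: "star w = w" "w * w = 1 - d *\<^sub>R g"
      "\<And>x. x * (d *\<^sub>R g) = (d *\<^sub>R g) * x \<Longrightarrow> x * w = w * x"
  proof -
    have "star (d *\<^sub>R g) = d *\<^sub>R g" by (simp add: star_scaleR sg)
    moreover have "norm (d *\<^sub>R g) \<le> 1" by (simp add: d_def add_nonneg_pos)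
    ultimately show ?thesis using ex_selfadjoint_sqrt that by blast
  qed
  have byc: "b * y = y * b" by (rule y(3)) (simp add: mult.assoc)
  have bg: "b * g = g * b" by (rule comm_g) (simp add: mult.assoc)
  have yg: "y * g = g * y" by (rule comm_g) (metis byc mult.assoc)
  have bw: "b * w = w * b" by (rule w(3)) (simp add: bg)
  have yw: "y * w = w * y" by (rule w(3)) (simp add: yg)
  define v where "v = y * w"
  have sv: "star v = v" by (simp add: v_def star_mult y w yw)
  have bv: "b * v = v * b" by (metis v_def byc bw mult.assoc)
  have "v * v = (y * y) * (w * w)" by (metis v_def yw mult.assoc)
  also have "\<dots> = 1 - b * b - d *\<^sub>R 1"
    by (simp only: y w right_diff_distrib mult_scaleR_right g mult.right_neutral)
  finally have vv: "b * b + v * v = (1 - d) *\<^sub>R 1" by (simp add: algebra_simps)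
  define u where "u = b + \<i> *\<^sub>C v"
  have "(norm u)\<^sup>2 = norm (star u * u)" by (simp add: norm_star_mult_self)
  also have "star u * u = b * b + v * v"
    by (simp add: u_def star_add star_scaleC sa sv algebra_simps mult_scaleC_left mult_scaleC_right
        scaleC_scaleC scaleC_minus_left scaleC_diff_right bv)
  finally have nu: "(norm u)\<^sup>2 = \<bar>1 - d\<bar> * norm (1::'a)" by (simp add: vv)
  have "star u + u = 2 *\<^sub>R b"
    by (simp add: u_def star_add star_scaleC sa sv scaleC_minus_left scaleR_2)
  then have "2 * norm b \<le> norm (star u) + norm u"
    using norm_triangle_ineq[of "star u" u] by simp
  then have bu: "norm b \<le> norm u" by (simp add: norm_star)
  have "(norm u)\<^sup>2 < 1"
    unfolding nu using d norm_one_le[where 'a = 'a] mult_left_le[of "norm (1::'a)" "1 - d"] by linarith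
  then have "norm u < 1" by (simp add: power_less_one_iff)
  then show ?thesis using bu by simp
qed

text \<open>
  The norm of a self-adjoint element is at most its spectral radius: if \<open>norm b\<close> and \<open>- norm b\<close> were
  both outside the spectrum, the preceding lemma would apply to \<open>b / norm b\<close>.
\<close>

lemma norm_selfadjoint_le:
  fixes b :: "'a::unital_cstar_algebra"
  assumes sa: "star b = b" and c: "0 \<le> c" and sp: "\<And>z. z \<in> spectrum b \<Longrightarrow> cmod z \<le> c"
  shows "norm b \<le> c"
proof (rule ccontr)
  assume "\<not> norm b \<le> c"
  then have nb: "c < norm b" "0 < norm b" using c by auto
  define n :: complex where "n = of_real (norm b)"
  have n: "cmod n = norm b" "n \<noteq> 0" using nb by (auto simp: n_def)
  define b' where "b' = (1 / norm b) *\<^sub>R b"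
  have "n \<notin> spectrum b" "- n \<notin> spectrum b" using sp[of n] sp[of "- n"] n nb by auto
  then have "invertible_element (b - n *\<^sub>C 1)" "invertible_element (b + n *\<^sub>C 1)"
    by (simp_all add: spectrum_iff scaleC_minus_left)
  then have "invertible_element ((- (1 / n\<^sup>2)) *\<^sub>C ((b - n *\<^sub>C 1) * (b + n *\<^sub>C 1)))"
    using n by (intro invertible_element_scaleC invertible_element_mult) auto
  also have "(b - n *\<^sub>C 1) * (b + n *\<^sub>C 1) = b * b - n\<^sup>2 *\<^sub>C 1"
    by (simp add: algebra_simps mult_scaleC_left mult_scaleC_right scaleC_scaleC power2_eq_square
        scaleC_diff_right scaleC_add_right)
  also have "(- (1 / n\<^sup>2)) *\<^sub>C (b * b - n\<^sup>2 *\<^sub>C 1) = 1 - b' * b'"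
    using n by (simp add: b'_def n_def scaleC_diff_right scaleC_scaleC scaleC_minus_left
        scaleR_scaleC mult_scaleC_left mult_scaleC_right power2_eq_square)
  finally have "norm b' < 1"
    by (intro norm_less_one_selfadjoint) (use nb in \<open>simp_all add: b'_def star_scaleR sa\<close>)
  then show False using nb by (simp add: b'_def)
qed


section \<open>Polynomials in an element\<close>

text \<open>The value \<open>p(a)\<close> of a complex polynomial \<open>p\<close>, computed by Horner's rule.\<close>

definition peval :: "complex poly \<Rightarrow> 'a::unital_cstar_algebra \<Rightarrow> 'a" where
  "peval p a = fold_coeffs (\<lambda>c b. c *\<^sub>C 1 + a * b) p 0"

lemma peval_0 [simp]: "peval 0 a = 0"
  by (simp add: peval_def)

lemma peval_pCons [simp]: "peval (pCons c p) a = c *\<^sub>C 1 + a * peval p a"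
  by (cases "p = 0"; cases "c = 0") (simp_all add: peval_def)

lemma peval_add: "peval (p + q) a = peval p a + peval q a"
  by (induction p q rule: poly_induct2) (simp_all add: scaleC_add_left algebra_simps)

lemma peval_smult: "peval (smult c p) a = c *\<^sub>C peval p a"
  by (induction p) (simp_all add: scaleC_add_right scaleC_scaleC mult_scaleC_right)

lemma peval_diff: "peval (p - q) a = peval p a - peval q a"
  using peval_add[of "p - q" q a] by simp

lemma peval_mult: "peval (p * q) a = peval p a * peval q a"
  by (induction p)
     (simp_all add: peval_add peval_smult distrib_right mult_scaleC_left mult.assoc)

lemma peval_commute: "a * peval p a = peval p a * a"
  using peval_mult[of "[:0, 1:]" p a] peval_mult[of p "[:0, 1:]" a] by (simp add: mult.commute)

lemma star_peval:
  assumes "star a = a"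
  shows "star (peval p a) = peval (map_poly cnj p) a"
  by (induction p)
     (simp_all add: map_poly_pCons star_add star_scaleC star_mult assms peval_commute)

text \<open>
  As complex polynomials split into linear factors, this is the inclusion of the spectrum of \<open>p(a)\<close> in
  the image of the spectrum of \<open>a\<close>.
\<close>

lemma invertible_element_peval:
  assumes "p \<noteq> 0" "\<And>z. z \<in> spectrum a \<Longrightarrow> poly p z \<noteq> 0"
  shows "invertible_element (peval p a)"
  using assms
proof (induction "degree p" arbitrary: p)
  case 0
  then obtain c where "p = [:c:]" "c \<noteq> 0"
    by (metis degree_eq_zeroE pCons_eq_0_iff)
  then show ?case
    using invertible_element_scaleC[OF invertible_element_one] by simp
next
  case (Suc n)
  then have "\<not> constant (poly p)"
    by (simp add: constant_degree)
  then obtain z where z: "poly p z = 0"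
    using fundamental_theorem_of_algebra by blast
  then obtain q where q: "p = [:- z, 1:] * q"
    by (meson dvdE poly_eq_0_iff_dvd)
  have q0: "q \<noteq> 0" using Suc.prems(1) q by auto
  then have "degree p = Suc (degree q)"
    unfolding q by (subst degree_mult_eq) auto
  then have "invertible_element (peval q a)"
    using Suc q q0 by (intro Suc.hyps) auto
  moreover have "invertible_element (a - z *\<^sub>C 1)"
    using Suc.prems(2)[of z] z by (auto simp: spectrum_iff)
  moreover have "peval p a = (a - z *\<^sub>C 1) * peval q a"
    unfolding q peval_mult by (simp add: scaleC_minus_left)
  ultimately show ?case
    by (simp add: invertible_element_mult)
qed

lemma norm_peval_le:
  fixes a :: "'a::unital_cstar_algebra"
  assumes sa: "star a = a" and c: "0 \<le> c"
    and le: "\<And>z. z \<in> spectrum a \<Longrightarrow> cmod (poly p z) \<le> c"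
  shows "norm (peval p a) \<le> c"
proof -
  define q where "q = map_poly cnj p * p"
  have q: "star (peval p a) * peval p a = peval q a"
    by (simp add: star_peval sa q_def peval_mult)
  have "norm (peval q a) \<le> c\<^sup>2"
  proof (rule norm_selfadjoint_le)
    show "star (peval q a) = peval q a"
      unfolding q[symmetric] by (simp add: star_mult star_star)
    fix w assume w: "w \<in> spectrum (peval q a)"
    show "cmod w \<le> c\<^sup>2"
    proof (rule ccontr)
      assume "\<not> cmod w \<le> c\<^sup>2"
      have nz: "poly (q - [:w:]) z \<noteq> 0" if "z \<in> spectrum a" for z
      proof -
        have "cnj z = z"
          using spectrum_selfadjoint_real[OF sa that] by (simp add: complex_eq_iff)
        then have "cmod (poly q z) = (cmod (poly p z))\<^sup>2"
          by (simp add: q_def norm_mult power2_eq_square)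
        also have "\<dots> \<le> c\<^sup>2"
          using le[OF that] by (simp add: power_mono)
        finally show ?thesis
          using \<open>\<not> cmod w \<le> c\<^sup>2\<close> by auto
      qed
      have "invertible_element (peval (q - [:w:]) a)"
      proof (cases "q - [:w:] = 0")
        \<comment> \<open>The polynomial can vanish only if the spectrum is empty, and then the algebra is zero.\<close>
        case True
        with nz have "spectrum a = {}" by auto
        then have "norm a \<le> 0" "0 \<notin> spectrum a"
          using norm_selfadjoint_le[OF sa, of 0] by auto
        then have "invertible_element (0::'a)" by (simp add: spectrum_iff)
        with True show ?thesis by simp
      next
        case False
        then show ?thesis using nz by (rule invertible_element_peval)
      qed
      then show False
        using w by (simp add: spectrum_iff peval_diff)
    qed
  qed (simp add: c)
  then have "(norm (peval p a))\<^sup>2 \<le> c\<^sup>2"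
    by (simp add: norm_star_mult_self flip: q)
  then show ?thesis
    using c by (rule power2_le_imp_le)
qed


section \<open>The continuous functional calculus of a self-adjoint element\<close>

lemma ex_poly_approx:
  fixes a :: "'a::unital_cstar_algebra"
  assumes sa: "star a = a" and f: "continuous_on (spectrum a) f" and e: "0 < e"
  shows "\<exists>p. \<forall>z\<in>spectrum a. cmod (poly p z - f z) < e"
proof -
  define R where "R = Re ` spectrum a"
  have z_eq: "z = of_real (Re z)" if "z \<in> spectrum a" for z
    using spectrum_selfadjoint_real[OF sa that] by (simp add: complex_eq_iff)
  have R: "compact R"
    unfolding R_def by (intro compact_continuous_image compact_spectrum continuous_intros)
  have "of_real ` R \<subseteq> spectrum a"
    unfolding R_def using z_eq by force
  then have cont: "continuous_on R (\<lambda>x. f (of_real x))"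
    by (intro continuous_on_compose2[OF f]) (auto intro!: continuous_intros)
  have approx: "\<exists>p. \<forall>x\<in>R. cmod (poly p (of_real x) - of_real (g x)) < e / 2"
    if g: "continuous_on R g" for g :: "real \<Rightarrow> real"
  proof -
    obtain h where h: "real_polynomial_function h" "\<And>x. x \<in> R \<Longrightarrow> \<bar>g x - h x\<bar> < e / 2"
      using Stone_Weierstrass_real_polynomial_function[OF R g, of "e / 2"] e by auto
    then obtain c n where c: "h = (\<lambda>x. \<Sum>i\<le>n. c i * x ^ i)"
      by (auto simp: real_polynomial_function_iff_sum)
    define p :: "complex poly" where "p = (\<Sum>i\<le>n. monom (of_real (c i)) i)"
    have "poly p (of_real x) = of_real (h x)" for x
      by (simp add: p_def c poly_sum poly_monom)
    then have "cmod (poly p (of_real x) - of_real (g x)) < e / 2" if "x \<in> R" for x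
      using h(2)[OF that] by (simp add: abs_minus_commute flip: of_real_diff)
    then show ?thesis by blast
  qed
  obtain p where p: "\<And>x. x \<in> R \<Longrightarrow> cmod (poly p (of_real x) - of_real (Re (f (of_real x)))) < e / 2"
    using approx[OF continuous_on_Re[OF cont]] by blast
  obtain q where q: "\<And>x. x \<in> R \<Longrightarrow> cmod (poly q (of_real x) - of_real (Im (f (of_real x)))) < e / 2"
    using approx[OF continuous_on_Im[OF cont]] by blast
  have "cmod (poly (p + smult \<i> q) z - f z) < e" if z: "z \<in> spectrum a" for z
  proof -
    define x where "x = Re z"
    have x: "z = of_real x" "x \<in> R" using z_eq z by (auto simp: x_def R_def)
    have "poly (p + smult \<i> q) z - f z = (poly p z - of_real (Re (f z)))
        + \<i> * (poly q z - of_real (Im (f z)))"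
      by (simp add: complex_eq_iff)
    also have "cmod \<dots> \<le> cmod (poly p z - of_real (Re (f z))) + cmod (poly q z - of_real (Im (f z)))"
      by (rule order_trans[OF norm_triangle_ineq]) (simp only: norm_mult norm_ii mult_1_left order_refl)
    also have "\<dots> < e" using p[OF x(2)] q[OF x(2)] by (simp add: x(1))
    finally show ?thesis .
  qed
  then show ?thesis by blast
qed

lemma ex_poly_uniform_limit:
  fixes a :: "'a::unital_cstar_algebra"
  assumes "star a = a" "continuous_on (spectrum a) f"
  shows "\<exists>p. uniform_limit (spectrum a) (\<lambda>n. poly (p n)) f sequentially"
proof -
  have "\<exists>p. \<forall>z\<in>spectrum a. cmod (poly p z - f z) < 1 / real (Suc n)" for n
    by (rule ex_poly_approx[OF assms]) simp
  then obtain p where p: "\<And>n z. z \<in> spectrum a \<Longrightarrow> cmod (poly (p n) z - f z) < 1 / real (Suc n)"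
    by metis
  have "uniform_limit (spectrum a) (\<lambda>n. poly (p n)) f sequentially"
    unfolding uniform_limit_sequentially_iff
  proof (intro allI impI)
    fix e :: real assume "0 < e"
    then obtain N where N: "1 / real (Suc N) < e"
      using reals_Archimedean[of e] by (auto simp: inverse_eq_divide)
    have "dist (poly (p n) z) (f z) < e" if "n \<ge> N" "z \<in> spectrum a" for n z
    proof -
      have "1 / real (Suc n) \<le> 1 / real (Suc N)"
        using that by (intro divide_left_mono) auto
      with p[OF that(2), of n] N show ?thesis by (simp add: dist_norm)
    qed
    then show "\<exists>N. \<forall>n\<ge>N. \<forall>x\<in>spectrum a. dist (poly (p n) x) (f x) < e" by blast
  qed
  then show ?thesis by blast
qed

lemma peval_diff_tendsto_0:
  fixes a :: "'a::unital_cstar_algebra"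
  assumes sa: "star a = a"
    and p: "uniform_limit (spectrum a) (\<lambda>n. poly (p n)) f sequentially"
    and q: "uniform_limit (spectrum a) (\<lambda>n. poly (q n)) f sequentially"
    and e: "0 < e"
  shows "\<exists>N. \<forall>m\<ge>N. \<forall>n\<ge>N. norm (peval (p m) a - peval (q n) a) \<le> e"
proof -
  obtain M where M: "\<And>n z. n \<ge> M \<Longrightarrow> z \<in> spectrum a \<Longrightarrow> dist (poly (p n) z) (f z) < e / 2"
    using p e unfolding uniform_limit_sequentially_iff by (meson half_gt_zero)
  obtain N where N: "\<And>n z. n \<ge> N \<Longrightarrow> z \<in> spectrum a \<Longrightarrow> dist (poly (q n) z) (f z) < e / 2"
    using q e unfolding uniform_limit_sequentially_iff by (meson half_gt_zero)
  have "norm (peval (p m - q n) a) \<le> e" if "m \<ge> max M N" "n \<ge> max M N" for m n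
  proof (rule norm_peval_le[OF sa])
    fix z assume z: "z \<in> spectrum a"
    then show "cmod (poly (p m - q n) z) \<le> e"
      using M[of m z] N[of n z] that dist_triangle2[of "poly (p m) z" "poly (q n) z" "f z"]
      by (simp add: dist_norm)
  qed (use e in simp)
  then show ?thesis unfolding peval_diff by blast
qed

text \<open>The limit of \<open>p\<^sub>n(a)\<close> for polynomials \<open>p\<^sub>n\<close> converging to \<open>f\<close> uniformly on the spectrum of \<open>a\<close>.\<close>

definition poly_limit :: "'a::unital_cstar_algebra \<Rightarrow> (complex \<Rightarrow> complex) \<Rightarrow> 'a" where
  "poly_limit a f = (SOME L. \<exists>p. uniform_limit (spectrum a) (\<lambda>n. poly (p n)) f sequentially \<and>
     (\<lambda>n. peval (p n) a) \<longlonglongrightarrow> L)"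

lemma tendsto_poly_limit:
  fixes a :: "'a::unital_cstar_algebra"
  assumes sa: "star a = a"
    and p: "uniform_limit (spectrum a) (\<lambda>n. poly (p n)) f sequentially"
  shows "(\<lambda>n. peval (p n) a) \<longlonglongrightarrow> poly_limit a f"
proof -
  have "Cauchy (\<lambda>n. peval (p n) a)"
  proof (rule CauchyI)
    fix e :: real assume "0 < e"
    then have e: "0 < e / 2" "\<And>x. x \<le> e / 2 \<Longrightarrow> x < e" by auto
    show "\<exists>M. \<forall>m\<ge>M. \<forall>n\<ge>M. norm (peval (p m) a - peval (p n) a) < e"
      using peval_diff_tendsto_0[OF sa p p e(1)] e(2) by meson
  qed
  then obtain L0 where "(\<lambda>n. peval (p n) a) \<longlonglongrightarrow> L0"
    using Cauchy_convergent_iff convergent_def by blast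
  with p have "\<exists>L. \<exists>p. uniform_limit (spectrum a) (\<lambda>n. poly (p n)) f sequentially \<and>
     (\<lambda>n. peval (p n) a) \<longlonglongrightarrow> L" by blast
  then have "\<exists>q. uniform_limit (spectrum a) (\<lambda>n. poly (q n)) f sequentially \<and>
     (\<lambda>n. peval (q n) a) \<longlonglongrightarrow> poly_limit a f"
    unfolding poly_limit_def by (rule someI_ex)
  then obtain q where q: "uniform_limit (spectrum a) (\<lambda>n. poly (q n)) f sequentially"
    "(\<lambda>n. peval (q n) a) \<longlonglongrightarrow> poly_limit a f" by blast
  have "(\<lambda>n. peval (p n) a - peval (q n) a) \<longlonglongrightarrow> 0"
  proof (rule LIMSEQ_I)
    fix e :: real assume "0 < e"
    then have e: "0 < e / 2" "\<And>x. x \<le> e / 2 \<Longrightarrow> x < e" by auto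
    show "\<exists>N. \<forall>n\<ge>N. norm (peval (p n) a - peval (q n) a - 0) < e"
      using peval_diff_tendsto_0[OF sa p q(1) e(1)] e(2) unfolding diff_0_right by meson
  qed
  from tendsto_add[OF this q(2)] show ?thesis by simp
qed

lemma is_functional_calculus_poly_limit:
  fixes a :: "'a::unital_cstar_algebra"
  assumes sa: "star a = a"
  shows "is_functional_calculus a (poly_limit a)"
proof -
  let ?K = "spectrum a"
  note lim = tendsto_poly_limit[OF sa]
  have bdd: "bounded (f ` ?K)" if "continuous_on ?K f" for f :: "complex \<Rightarrow> complex"
    using that by (intro compact_imp_bounded compact_continuous_image compact_spectrum)
  have eqI: "poly_limit a f = L"
    if "uniform_limit ?K (\<lambda>n. poly (p n)) f sequentially" "(\<lambda>n. peval (p n) a) \<longlonglongrightarrow> L" for f p L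
    using lim[OF that(1)] that(2) LIMSEQ_unique by blast
  have cong: "poly_limit a f = poly_limit a g" if "\<forall>z\<in>?K. f z = g z" for f g
  proof -
    have "uniform_limit ?K X f sequentially \<longleftrightarrow> uniform_limit ?K X g sequentially" for X
      using that by (intro uniform_limit_cong') auto
    then show ?thesis by (simp add: poly_limit_def)
  qed
  have add: "poly_limit a (\<lambda>z. f z + g z) = poly_limit a f + poly_limit a g"
    and mult: "poly_limit a (\<lambda>z. f z * g z) = poly_limit a f * poly_limit a g"
    if f: "continuous_on ?K f" and g: "continuous_on ?K g" for f g
  proof -
    obtain p where p: "uniform_limit ?K (\<lambda>n. poly (p n)) f sequentially"
      using ex_poly_uniform_limit[OF sa f] by blast
    obtain q where q: "uniform_limit ?K (\<lambda>n. poly (q n)) g sequentially"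
      using ex_poly_uniform_limit[OF sa g] by blast
    show "poly_limit a (\<lambda>z. f z + g z) = poly_limit a f + poly_limit a g"
    proof (rule eqI[where p = "\<lambda>n. p n + q n"])
      show "uniform_limit ?K (\<lambda>n. poly (p n + q n)) (\<lambda>z. f z + g z) sequentially"
        using uniform_limit_add[OF p q] by (simp add: poly_add[abs_def])
      show "(\<lambda>n. peval (p n + q n) a) \<longlonglongrightarrow> poly_limit a f + poly_limit a g"
        unfolding peval_add by (intro tendsto_add lim p q)
    qed
    show "poly_limit a (\<lambda>z. f z * g z) = poly_limit a f * poly_limit a g"
    proof (rule eqI[where p = "\<lambda>n. p n * q n"])
      show "uniform_limit ?K (\<lambda>n. poly (p n * q n)) (\<lambda>z. f z * g z) sequentially"
        using uniform_lim_mult[OF p q bdd[OF f] bdd[OF g]] by (simp add: poly_mult[abs_def])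
      show "(\<lambda>n. peval (p n * q n) a) \<longlonglongrightarrow> poly_limit a f * poly_limit a g"
        unfolding peval_mult by (intro tendsto_mult lim p q)
    qed
  qed
  have cnj: "poly_limit a (\<lambda>z. cnj (f z)) = star (poly_limit a f)" if f: "continuous_on ?K f" for f
  proof -
    obtain p where p: "uniform_limit ?K (\<lambda>n. poly (p n)) f sequentially"
      using ex_poly_uniform_limit[OF sa f] by blast
    show ?thesis
    proof (rule eqI[where p = "\<lambda>n. map_poly cnj (p n)"])
      have "cnj z = z" if "z \<in> ?K" for z
        using spectrum_selfadjoint_real[OF sa that] by (simp add: complex_eq_iff)
      then show "uniform_limit ?K (\<lambda>n. poly (map_poly cnj (p n))) (\<lambda>z. cnj (f z)) sequentially"
        using p by (simp add: uniform_limit_sequentially_iff dist_norm flip: complex_cnj_diff)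
      show "(\<lambda>n. peval (map_poly cnj (p n)) a) \<longlonglongrightarrow> star (poly_limit a f)"
        unfolding star_peval[OF sa, symmetric]
        by (rule bounded_linear.tendsto[OF bounded_linear_star lim[OF p]])
    qed
  qed
  have pol: "poly_limit a (poly p) = peval p a" for p
    by (rule eqI[where p = "\<lambda>_. p"]) (auto simp: uniform_limit_sequentially_iff)
  have scale: "poly_limit a (\<lambda>z. c * f z) = c *\<^sub>C poly_limit a f" if "continuous_on ?K f" for c f
  proof -
    have "poly_limit a (\<lambda>z. c) = c *\<^sub>C 1"
      using pol[of "[:c:]"] by (simp add: poly_pCons[abs_def])
    then show ?thesis
      using mult[OF _ that, of "\<lambda>_. c"] by (simp add: mult_scaleC_left)
  qed
  show ?thesis
    unfolding is_functional_calculus_def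
    using cong add mult scale cnj pol[of "[:1:]"] pol[of "[:0, 1:]"] by (simp add: poly_pCons[abs_def])
qed

lemma
  assumes "is_functional_calculus a \<Phi>"
  shows is_functional_calculus_cong:
      "continuous_on (spectrum a) f \<Longrightarrow> (\<And>z. z \<in> spectrum a \<Longrightarrow> f z = g z) \<Longrightarrow> \<Phi> f = \<Phi> g"
    and is_functional_calculus_add: "continuous_on (spectrum a) f \<Longrightarrow> continuous_on (spectrum a) g
      \<Longrightarrow> \<Phi> (\<lambda>z. f z + g z) = \<Phi> f + \<Phi> g"
    and is_functional_calculus_mult: "continuous_on (spectrum a) f \<Longrightarrow> continuous_on (spectrum a) g
      \<Longrightarrow> \<Phi> (\<lambda>z. f z * g z) = \<Phi> f * \<Phi> g"
    and is_functional_calculus_scaleC: "continuous_on (spectrum a) f \<Longrightarrow> \<Phi> (\<lambda>z. c * f z) = c *\<^sub>C \<Phi> f"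
    and is_functional_calculus_cnj: "continuous_on (spectrum a) f \<Longrightarrow> \<Phi> (\<lambda>z. cnj (f z)) = star (\<Phi> f)"
    and is_functional_calculus_one: "\<Phi> (\<lambda>z. 1) = 1"
    and is_functional_calculus_id: "\<Phi> (\<lambda>z. z) = a"
  using assms unfolding is_functional_calculus_def by blast+

lemma is_functional_calculus_diff:
  assumes \<Phi>: "is_functional_calculus a \<Phi>"
    and f: "continuous_on (spectrum a) f" and g: "continuous_on (spectrum a) g"
  shows "\<Phi> (\<lambda>z. f z - g z) = \<Phi> f - \<Phi> g"
  using is_functional_calculus_add[OF \<Phi> f, of "\<lambda>z. (- 1) * g z"]
    is_functional_calculus_scaleC[OF \<Phi> g, of "- 1"] g
  by (simp add: continuous_on_minus scaleC_minus_left)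

lemma is_functional_calculus_const:
  assumes "is_functional_calculus a \<Phi>"
  shows "\<Phi> (\<lambda>z. c) = c *\<^sub>C 1"
  using is_functional_calculus_scaleC[OF assms, of "\<lambda>z. 1" c] is_functional_calculus_one[OF assms]
  by simp

lemma spectrum_functional_calculus_subset:
  assumes \<Phi>: "is_functional_calculus a \<Phi>" and f: "continuous_on (spectrum a) f"
  shows "spectrum (\<Phi> f) \<subseteq> f ` spectrum a"
proof
  fix w assume w: "w \<in> spectrum (\<Phi> f)"
  show "w \<in> f ` spectrum a"
  proof (rule ccontr)
    assume w': "w \<notin> f ` spectrum a"
    define h where "h z = f z - w" for z
    have h: "continuous_on (spectrum a) h"
      unfolding h_def by (intro continuous_intros f)
    have h0: "h z \<noteq> 0" if "z \<in> spectrum a" for z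
      using w' that by (auto simp: h_def)
    have hi: "continuous_on (spectrum a) (\<lambda>z. inverse (h z))"
      using h h0 by (intro continuous_intros) auto
    have "\<Phi> h = \<Phi> f - w *\<^sub>C 1"
      unfolding h_def by (simp add: is_functional_calculus_diff[OF \<Phi>] f is_functional_calculus_const[OF \<Phi>])
    moreover have "\<Phi> h * \<Phi> (\<lambda>z. inverse (h z)) = 1"
      unfolding is_functional_calculus_mult[OF \<Phi> h hi, symmetric]
        is_functional_calculus_one[OF \<Phi>, symmetric]
      by (rule is_functional_calculus_cong[OF \<Phi>]) (auto intro!: continuous_intros h hi simp: h0)
    moreover have "\<Phi> (\<lambda>z. inverse (h z)) * \<Phi> h = 1"
      unfolding is_functional_calculus_mult[OF \<Phi> hi h, symmetric]
        is_functional_calculus_one[OF \<Phi>, symmetric]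
      by (rule is_functional_calculus_cong[OF \<Phi>]) (auto intro!: continuous_intros h hi simp: h0)
    ultimately have "invertible_element (\<Phi> f - w *\<^sub>C 1)"
      by (auto simp: invertible_element_def)
    then show False using w by (simp add: spectrum_iff)
  qed
qed

lemma norm_functional_calculus_le:
  assumes \<Phi>: "is_functional_calculus a \<Phi>" and f: "continuous_on (spectrum a) f"
    and c: "0 \<le> c" and le: "\<And>z. z \<in> spectrum a \<Longrightarrow> cmod (f z) \<le> c"
  shows "norm (\<Phi> f) \<le> c"
proof -
  have f': "continuous_on (spectrum a) (\<lambda>z. cnj (f z))" by (intro continuous_intros f)
  have eq: "star (\<Phi> f) * \<Phi> f = \<Phi> (\<lambda>z. cnj (f z) * f z)"
    by (simp add: is_functional_calculus_mult[OF \<Phi> f' f] is_functional_calculus_cnj[OF \<Phi> f])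
  have "norm (\<Phi> (\<lambda>z. cnj (f z) * f z)) \<le> c\<^sup>2"
  proof (rule norm_selfadjoint_le)
    show "star (\<Phi> (\<lambda>z. cnj (f z) * f z)) = \<Phi> (\<lambda>z. cnj (f z) * f z)"
      unfolding eq[symmetric] by (simp add: star_mult star_star)
    fix w assume "w \<in> spectrum (\<Phi> (\<lambda>z. cnj (f z) * f z))"
    then obtain z where z: "z \<in> spectrum a" "w = cnj (f z) * f z"
      using spectrum_functional_calculus_subset[OF \<Phi>, of "\<lambda>z. cnj (f z) * f z"]
        continuous_on_mult[OF f' f] by auto
    show "cmod w \<le> c\<^sup>2"
      using le[OF z(1)] by (simp add: z norm_mult power2_eq_square mult_mono c)
  qed (simp add: c)
  then have "(norm (\<Phi> f))\<^sup>2 \<le> c\<^sup>2"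
    by (simp add: norm_star_mult_self flip: eq)
  then show ?thesis
    using c by (rule power2_le_imp_le)
qed

lemma functional_calculus_eq:
  assumes sa: "star a = a" and \<Phi>: "is_functional_calculus a \<Phi>" and f: "continuous_on (spectrum a) f"
  shows "functional_calculus a f = \<Phi> f"
proof -
  have poly: "\<Psi> (poly p) = peval p a" if \<Psi>: "is_functional_calculus a \<Psi>" for \<Psi> p
  proof (induction p)
    case 0
    show ?case using is_functional_calculus_const[OF \<Psi>, of 0] by (simp add: poly_0[abs_def])
  next
    case (pCons c p)
    have "\<Psi> (poly (pCons c p)) = \<Psi> (\<lambda>z. c + z * poly p z)" by (simp add: poly_pCons[abs_def])
    also have "\<dots> = c *\<^sub>C 1 + a * \<Psi> (poly p)"
      by (simp add: is_functional_calculus_add[OF \<Psi>] is_functional_calculus_mult[OF \<Psi>]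
          is_functional_calculus_const[OF \<Psi>] is_functional_calculus_id[OF \<Psi>] continuous_on_mult
          continuous_on_poly continuous_on_id)
    finally show ?case unfolding pCons.IH peval_pCons .
  qed
  have uniq: "\<Psi> f = poly_limit a f" if \<Psi>: "is_functional_calculus a \<Psi>" for \<Psi>
  proof -
    obtain p where p: "uniform_limit (spectrum a) (\<lambda>n. poly (p n)) f sequentially"
      using ex_poly_uniform_limit[OF sa f] by blast
    have "(\<lambda>n. peval (p n) a) \<longlonglongrightarrow> \<Psi> f"
    proof (rule LIMSEQ_I)
      fix e :: real assume e: "0 < e"
      then obtain N where N: "\<And>n z. n \<ge> N \<Longrightarrow> z \<in> spectrum a \<Longrightarrow> dist (poly (p n) z) (f z) < e / 2"
        using p unfolding uniform_limit_sequentially_iff by (meson half_gt_zero)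
      have "norm (peval (p n) a - \<Psi> f) < e" if "n \<ge> N" for n
      proof -
        have "norm (\<Psi> (\<lambda>z. poly (p n) z - f z)) \<le> e / 2"
          by (rule norm_functional_calculus_le[OF \<Psi>])
             (use N[OF that] e in \<open>auto intro!: continuous_intros f less_imp_le simp: dist_norm\<close>)
        also have "\<Psi> (\<lambda>z. poly (p n) z - f z) = peval (p n) a - \<Psi> f"
          using is_functional_calculus_diff[OF \<Psi> _ f, of "poly (p n)"] poly[OF \<Psi>]
          by (simp add: continuous_on_poly continuous_on_id)
        finally show ?thesis using e by simp
      qed
      then show "\<exists>N. \<forall>n\<ge>N. norm (peval (p n) a - \<Psi> f) < e" by blast
    qed
    then show ?thesis
      using tendsto_poly_limit[OF sa p] LIMSEQ_unique by blast
  qed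
  show ?thesis
    unfolding functional_calculus_def
  proof (rule the_equality)
    show "\<exists>\<Psi>. is_functional_calculus a \<Psi> \<and> \<Phi> f = \<Psi> f" using \<Phi> by blast
    show "b = \<Phi> f" if "\<exists>\<Psi>. is_functional_calculus a \<Psi> \<and> b = \<Psi> f" for b
      using that uniq \<Phi> by metis
  qed
qed


section \<open>Real functions of a positive element\<close>

text \<open>
  The element \<open>f(a)\<close> for positive \<open>a\<close> and a real function \<open>f\<close>.  The spectrum of \<open>a\<close> lies in
  \<open>[0, norm a]\<close>, and the lemmas below ask for continuity of \<open>f\<close> on this interval.
\<close>

definition rfc :: "'a::unital_cstar_algebra \<Rightarrow> (real \<Rightarrow> real) \<Rightarrow> 'a" where
  "rfc a f = functional_calculus a (\<lambda>z. complex_of_real (f (Re z)))"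

lemma cstar_powr_eq_rfc: "cstar_powr a t = rfc a (\<lambda>x. x powr t)"
  by (simp add: cstar_powr_def rfc_def)

lemma cstar_positive_selfadjoint: "cstar_positive a \<Longrightarrow> star a = a"
  by (simp add: cstar_positive_def)

lemma spectrum_positive:
  assumes "cstar_positive a" "z \<in> spectrum a"
  shows "Re z \<in> {0..norm a}" "complex_of_real (Re z) = z"
proof -
  have "0 \<le> Re z" "Im z = 0"
    using assms by (auto simp: cstar_positive_def complex_nonneg_Reals_iff)
  moreover have "Re z \<le> norm a"
    using spectrum_bound[OF assms(2)] complex_Re_le_cmod[of z] by linarith
  ultimately show "Re z \<in> {0..norm a}" "complex_of_real (Re z) = z"
    by (simp_all add: complex_eq_iff)
qed

context
  fixes a :: "'a::unital_cstar_algebra"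
  assumes pos: "cstar_positive a"
begin

lemma continuous_on_rfc:
  "continuous_on {0..norm a} f \<Longrightarrow> continuous_on (spectrum a) (\<lambda>z. complex_of_real (f (Re z)))"
  by (rule continuous_on_compose2[of "{0..norm a}"])
     (use spectrum_positive[OF pos] in \<open>auto intro!: continuous_intros\<close>)

lemma rfc_eq_poly_limit:
  assumes "continuous_on {0..norm a} f"
  shows "rfc a f = poly_limit a (\<lambda>z. complex_of_real (f (Re z)))"
  unfolding rfc_def
  using cstar_positive_selfadjoint[OF pos] continuous_on_rfc[OF assms]
  by (intro functional_calculus_eq is_functional_calculus_poly_limit)

lemmas is_functional_calculus_positive = is_functional_calculus_poly_limit[OF cstar_positive_selfadjoint[OF pos]]

lemma rfc_cong:
  assumes f: "continuous_on {0..norm a} f" and eq: "\<And>x. x \<in> {0..norm a} \<Longrightarrow> f x = g x"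
  shows "rfc a f = rfc a g"
proof -
  have g: "continuous_on {0..norm a} g"
    using f by (rule continuous_on_eq) (rule eq)
  show ?thesis
    unfolding rfc_eq_poly_limit[OF f] rfc_eq_poly_limit[OF g]
    by (rule is_functional_calculus_cong[OF is_functional_calculus_positive continuous_on_rfc[OF f]])
       (use eq spectrum_positive[OF pos] in auto)
qed

lemma
  assumes f: "continuous_on {0..norm a} f" and g: "continuous_on {0..norm a} g"
  shows rfc_add: "rfc a (\<lambda>x. f x + g x) = rfc a f + rfc a g"
    and rfc_mult: "rfc a (\<lambda>x. f x * g x) = rfc a f * rfc a g"
  using is_functional_calculus_add[OF is_functional_calculus_positive continuous_on_rfc[OF f] continuous_on_rfc[OF g]]
    is_functional_calculus_mult[OF is_functional_calculus_positive continuous_on_rfc[OF f] continuous_on_rfc[OF g]] f g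
  by (simp_all add: rfc_eq_poly_limit continuous_on_add continuous_on_mult)

lemma rfc_scaleR:
  assumes f: "continuous_on {0..norm a} f"
  shows "rfc a (\<lambda>x. c * f x) = c *\<^sub>R rfc a f"
  using is_functional_calculus_scaleC[OF is_functional_calculus_positive continuous_on_rfc[OF f], of "of_real c"] f
  by (simp add: rfc_eq_poly_limit continuous_on_mult_left scaleR_scaleC)

lemma rfc_one: "rfc a (\<lambda>x. 1) = 1"
  using is_functional_calculus_one[OF is_functional_calculus_positive] by (simp add: rfc_eq_poly_limit)

lemma rfc_id: "rfc a (\<lambda>x. x) = a"
proof -
  have "rfc a (\<lambda>x. x) = poly_limit a (\<lambda>z. complex_of_real (Re z))"
    by (intro rfc_eq_poly_limit continuous_intros)
  also have "\<dots> = poly_limit a (\<lambda>z. z)"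
    using spectrum_positive(2)[OF pos]
    by (intro is_functional_calculus_cong[OF is_functional_calculus_positive]) (auto intro!: continuous_intros)
  finally show ?thesis
    by (simp add: is_functional_calculus_id[OF is_functional_calculus_positive])
qed

lemma rfc_selfadjoint:
  assumes f: "continuous_on {0..norm a} f"
  shows "star (rfc a f) = rfc a f"
  using is_functional_calculus_cnj[OF is_functional_calculus_positive continuous_on_rfc[OF f]]
  by (simp add: rfc_eq_poly_limit[OF f])

lemma rfc_positive:
  assumes f: "continuous_on {0..norm a} f" and nn: "\<And>x. x \<in> {0..norm a} \<Longrightarrow> 0 \<le> f x"
  shows "cstar_positive (rfc a f)"
  unfolding cstar_positive_def
proof
  have "spectrum (rfc a f) \<subseteq> (\<lambda>z. complex_of_real (f (Re z))) ` spectrum a"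
    unfolding rfc_eq_poly_limit[OF f]
    by (rule spectrum_functional_calculus_subset[OF is_functional_calculus_positive continuous_on_rfc[OF f]])
  then show "spectrum (rfc a f) \<subseteq> \<real>\<^sub>\<ge>\<^sub>0"
    using nn spectrum_positive(1)[OF pos] by fastforce
qed (rule rfc_selfadjoint[OF f])

end


section \<open>Positive operators\<close>

text \<open>The real part of the sesquilinear form of \<open>T\<close>; on the diagonal, the quadratic form of \<open>T\<close>.\<close>

definition bform :: "'h::complex_hilbert_space bop \<Rightarrow> 'h \<Rightarrow> 'h \<Rightarrow> real" where
  "bform T v w = Re (cinner (bop_apply T v) w)"

lemma bform_add: "bform (S + T) v w = bform S v w + bform T v w"
  by (simp add: bform_def bop_apply_add_left cinner_add_left)

lemma bform_diff: "bform (S - T) v w = bform S v w - bform T v w"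
  by (simp add: bform_def bop_apply_diff_left cinner_diff_left)

lemma bform_scaleR: "bform (r *\<^sub>R T) v w = r * bform T v w"
  by (simp add: bform_def bop_apply_scaleR_left cinner_scaleR_left)

lemma bform_zero [simp]: "bform 0 v w = 0"
  using bform_scaleR[of 0 0] by simp

lemma bform_sum: "bform (\<Sum>i\<in>A. T i) v w = (\<Sum>i\<in>A. bform (T i) v w)"
  by (induction A rule: infinite_finite_induct) (simp_all add: bform_add)

lemma bform_one: "bform 1 v v = (norm v)\<^sup>2"
  by (simp add: bform_def bop_apply_one Re_cinner_self)

lemma bform_conj: "star D = D \<Longrightarrow> bform (D * T * D) v v = bform T (bop_apply D v) (bop_apply D v)"
  using cinner_star_right[of "bop_apply T (bop_apply D v)" D v]
  by (simp add: bform_def bop_apply_mult)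

lemma bform_le: "bform T v v \<le> norm T * (norm v)\<^sup>2"
proof -
  have "bform T v v \<le> cmod (cinner (bop_apply T v) v)"
    by (simp add: bform_def complex_Re_le_cmod)
  also have "\<dots> \<le> norm (bop_apply T v) * norm v"
    by (rule cmod_cinner_le)
  also have "\<dots> \<le> (norm T * norm v) * norm v"
    by (intro mult_right_mono norm_bop_apply_le) simp
  finally show ?thesis by (simp add: power2_eq_square mult_ac)
qed

lemma bform_quadratic:
  assumes sa: "star T = T"
  shows "bform T (r *\<^sub>R v - w) (r *\<^sub>R v - w) = r\<^sup>2 * bform T v v - 2 * r * bform T v w + bform T w w"
proof -
  have "Re (cinner (bop_apply T w) v) = Re (cinner (bop_apply T v) w)"
    using cinner_star_right[of w T v] sa Re_cinner_commute[of "bop_apply T v" w] by simp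
  then show ?thesis
    by (simp add: bform_def bounded_linear.linear[OF bounded_linear_bop_apply] linear_diff linear_scale
        cinner_diff_left cinner_diff_right cinner_scaleR_left cinner_scaleR_right power2_eq_square
        algebra_simps)
qed

text \<open>
  A positive operator is the square of its self-adjoint root.  Conversely, if the quadratic form of \<open>T\<close> is
  nonnegative and \<open>t > 0\<close>, then \<open>1 - e (T + t)\<close> has norm less than \<open>1\<close> for small \<open>e > 0\<close>, so \<open>T + t\<close> is
  invertible.
\<close>

lemma cstar_positive_bop_iff:
  fixes T :: "'h::complex_hilbert_space bop"
  assumes sa: "star T = T"
  shows "cstar_positive T \<longleftrightarrow> (\<forall>v. 0 \<le> bform T v v)"
proof
  assume pos: "cstar_positive T"
  define R where "R = rfc T sqrt"
  have cont: "continuous_on {0..norm T} sqrt" by (intro continuous_intros)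
  have sR: "star R = R" unfolding R_def by (rule rfc_selfadjoint[OF pos cont])
  have "R * 1 * R = rfc T (\<lambda>x. sqrt x * sqrt x)"
    by (simp only: R_def rfc_mult[OF pos cont cont] mult.right_neutral)
  also have "\<dots> = rfc T (\<lambda>x. x)"
    by (rule rfc_cong[OF pos]) (auto intro!: continuous_intros)
  finally have "R * 1 * R = T" by (simp add: rfc_id[OF pos])
  then show "\<forall>v. 0 \<le> bform T v v"
    using bform_conj[OF sR, of 1] by (simp add: bform_one)
next
  assume nn: "\<forall>v. 0 \<le> bform T v v"
  have "invertible_element (T + t *\<^sub>R 1)" if t: "t > 0" for t :: real
  proof -
    define B where "B = T + t *\<^sub>R 1"
    define e where "e = t / ((norm B)\<^sup>2 + t\<^sup>2)"
    have den: "(norm B)\<^sup>2 + t\<^sup>2 > 0" using t by (simp add: add_nonneg_pos)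
    then have e: "e > 0" using t by (simp add: e_def)
    define c where "c = 1 - 2 * e * t + e\<^sup>2 * (norm B)\<^sup>2"
    have bd: "(norm (bop_apply (1 - e *\<^sub>R B) v))\<^sup>2 \<le> c * (norm v)\<^sup>2" for v
    proof -
      have "bform B v v \<ge> t * (norm v)\<^sup>2"
        using nn by (simp add: B_def bform_add bform_scaleR bform_one)
      moreover have "(norm (bop_apply B v))\<^sup>2 \<le> (norm B)\<^sup>2 * (norm v)\<^sup>2"
        using power_mono[OF norm_bop_apply_le[of B v], of 2] by (simp add: power_mult_distrib)
      moreover have "(norm (bop_apply (1 - e *\<^sub>R B) v))\<^sup>2
          = (norm v)\<^sup>2 - 2 * e * bform B v v + e\<^sup>2 * (norm (bop_apply B v))\<^sup>2"
        by (simp add: bop_apply_diff_left bop_apply_one bop_apply_scaleR_left norm_diff_sqr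
            cinner_scaleR_right bform_def Re_cinner_commute[of v] power_mult_distrib)
      ultimately have "(norm (bop_apply (1 - e *\<^sub>R B) v))\<^sup>2
          \<le> (norm v)\<^sup>2 - 2 * e * (t * (norm v)\<^sup>2) + e\<^sup>2 * ((norm B)\<^sup>2 * (norm v)\<^sup>2)"
        using e by (simp only:) (intro add_mono diff_mono mult_left_mono; simp)
      then show ?thesis by (simp add: c_def left_diff_distrib distrib_right mult.assoc)
    qed
    have "e * ((norm B)\<^sup>2 + t\<^sup>2) = t" using den by (simp add: e_def)
    moreover have "0 \<le> e * t\<^sup>2" using e by simp
    ultimately have "e * (norm B)\<^sup>2 \<le> t" by (simp add: distrib_left)
    then have "e * (e * (norm B)\<^sup>2) \<le> e * t" using e by (intro mult_left_mono) auto
    then have "c < 1" using e t mult_pos_pos[OF e t] by (simp add: c_def power2_eq_square mult.assoc)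
    define d where "d = sqrt (max c 0)"
    have d: "d < 1" "d \<ge> 0" "c \<le> d\<^sup>2"
      using \<open>c < 1\<close> by (auto simp: d_def max_def)
    have "norm (1 - e *\<^sub>R B) \<le> d"
    proof (rule norm_bop_le)
      fix v
      have "(norm (bop_apply (1 - e *\<^sub>R B) v))\<^sup>2 \<le> d\<^sup>2 * (norm v)\<^sup>2"
        using bd[of v] mult_right_mono[OF d(3), of "(norm v)\<^sup>2"] by simp
      also have "\<dots> = (d * norm v)\<^sup>2" by (simp add: power_mult_distrib)
      finally show "norm (bop_apply (1 - e *\<^sub>R B) v) \<le> d * norm v"
        by (rule power2_le_imp_le) (simp add: d)
    qed (rule d)
    then have "invertible_element (1 - (1 - e *\<^sub>R B))"
      using d by (intro invertible_element_one_minus) simp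
    then have "invertible_element (of_real (1 / e) *\<^sub>C (e *\<^sub>R B))"
      using e by (intro invertible_element_scaleC) auto
    also have "of_real (1 / e) *\<^sub>C (e *\<^sub>R B) = B"
      using e by (subst scaleR_scaleC[symmetric]) simp
    finally show ?thesis by (simp add: B_def)
  qed
  then have inv: "- complex_of_real t \<notin> spectrum T" if "t > 0" for t
    using that by (simp add: spectrum_iff scaleC_minus_left scaleR_scaleC)
  have "z \<in> \<real>\<^sub>\<ge>\<^sub>0" if "z \<in> spectrum T" for z
  proof -
    have "Im z = 0" by (rule spectrum_selfadjoint_real[OF sa that])
    then have "z = - complex_of_real (- Re z)" by (simp add: complex_eq_iff)
    with inv[of "- Re z"] that have "\<not> - Re z > 0" by metis
    with \<open>Im z = 0\<close> show ?thesis by (simp add: complex_nonneg_Reals_iff)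
  qed
  then show "cstar_positive T" using sa by (auto simp: cstar_positive_def)
qed

lemma cstar_le_bop_iff:
  assumes "star S = S" "star T = T"
  shows "S \<preceq> T \<longleftrightarrow> (\<forall>v. bform S v v \<le> bform T v v)"
  unfolding cstar_le_def
  by (subst cstar_positive_bop_iff) (simp_all add: assms star_diff bform_diff)


section \<open>Positive operator-valued maps on continuous functions\<close>

text \<open>
  A positive real-linear map from the continuous functions on \<open>[0, m]\<close> to the operators.  Continuous
  functions are represented by functions on the whole line, whence the congruence axiom.
\<close>

locale positive_operator_map =
  fixes m :: real and E :: "(real \<Rightarrow> real) \<Rightarrow> 'h::complex_hilbert_space bop"
  assumes E_cong: "continuous_on {0..m} f \<Longrightarrow> (\<And>x. x \<in> {0..m} \<Longrightarrow> f x = g x) \<Longrightarrow> E f = E g"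
    and E_add: "continuous_on {0..m} f \<Longrightarrow> continuous_on {0..m} g \<Longrightarrow>
      E (\<lambda>x. f x + g x) = E f + E g"
    and E_scaleR: "continuous_on {0..m} f \<Longrightarrow> E (\<lambda>x. c * f x) = c *\<^sub>R E f"
    and E_positive: "continuous_on {0..m} f \<Longrightarrow> (\<And>x. x \<in> {0..m} \<Longrightarrow> 0 \<le> f x) \<Longrightarrow>
      cstar_positive (E f)"
begin

lemma E_zero: "E (\<lambda>x. 0) = 0"
  using E_scaleR[of "\<lambda>x. 0" 0] by simp

lemma E_sum:
  assumes "\<And>i. i \<in> A \<Longrightarrow> continuous_on {0..m} (f i)"
  shows "E (\<lambda>x. \<Sum>i\<in>A. c i * f i x) = (\<Sum>i\<in>A. c i *\<^sub>R E (f i))"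
  using assms
proof (induction A rule: infinite_finite_induct)
  case (insert i A)
  then have "E (\<lambda>x. c i * f i x + (\<Sum>i\<in>A. c i * f i x)) = E (\<lambda>x. c i * f i x) + E (\<lambda>x. \<Sum>i\<in>A. c i * f i x)"
    by (intro E_add continuous_intros) auto
  with insert show ?case by (simp add: E_scaleR)
qed (simp_all add: E_zero)

lemma bform_nonneg:
  assumes "continuous_on {0..m} f" "\<And>x. x \<in> {0..m} \<Longrightarrow> 0 \<le> f x"
  shows "0 \<le> bform (E f) v v"
  using E_positive[OF assms] cstar_positive_bop_iff cstar_positive_selfadjoint by blast

lemma bform_mono:
  assumes f: "continuous_on {0..m} f" and g: "continuous_on {0..m} g"
    and le: "\<And>x. x \<in> {0..m} \<Longrightarrow> f x \<le> g x"
  shows "bform (E f) v v \<le> bform (E g) v v"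
proof -
  have "0 \<le> bform (E (\<lambda>x. g x + (- 1) * f x)) v v"
    using le by (intro bform_nonneg continuous_intros f g) auto
  also have "E (\<lambda>x. g x + (- 1) * f x) = E g + E (\<lambda>x. (- 1) * f x)"
    by (intro E_add continuous_intros f g)
  also have "\<dots> = E g + (- 1) *\<^sub>R E f"
    by (simp only: E_scaleR[OF f])
  finally show ?thesis by (simp add: bform_add bform_scaleR bform_diff)
qed

text \<open>
  For numbers this is \<open>f / (f + l) |h|\<^sup>2 \<le> f |w|\<^sup>2 / l + |h - w|\<^sup>2\<close>, which in terms of
  \<open>k = 1 + f / l\<close> says that \<open>k |w|\<^sup>2 - 2 Re (w h\<^sup>*) + |h|\<^sup>2 / k \<ge> 0\<close>.  The operator version of the latter
  (\<open>choi\<close> below, Choi's inequality for inverses as a statement about quadratic forms) is obtained from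
  the Bernstein polynomials \<open>B\<^sub>i\<close> in \<open>f / M\<close>, where \<open>f \<le> M\<close>.  They form a partition of unity with
  \<open>k = (\<Sum>i. t\<^sub>i B\<^sub>i)\<close>, where \<open>t\<^sub>i\<close> are the values of \<open>k\<close> at the nodes, and \<open>1 / k\<close> is approximated by
  \<open>(\<Sum>i. B\<^sub>i / t\<^sub>i)\<close>; it suffices to add up the values of the positive forms \<open>E B\<^sub>i / t\<^sub>i\<close> at
  \<open>t\<^sub>i w - h\<close>.
\<close>

lemma bform_resolvent_le:
  assumes f: "continuous_on {0..m} f" and nn: "\<And>x. x \<in> {0..m} \<Longrightarrow> 0 \<le> f x" and l: "0 < l"
  shows "bform (E (\<lambda>x. f x / (f x + l))) h h
      \<le> bform (E f) w w / l + bform (E (\<lambda>x. 1)) (h - w) (h - w)"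
proof -
  have fl: "f x + l > 0" if "x \<in> {0..m}" for x using nn[OF that] l by simp
  have cl: "continuous_on {0..m} (\<lambda>x. l / (f x + l))" "continuous_on {0..m} (\<lambda>x. f x / (f x + l))"
    using fl by (intro continuous_intros f; force)+
  have "bounded (f ` {0..m})"
    by (intro compact_imp_bounded compact_continuous_image f) simp
  then obtain M where M: "M > 0" "\<And>x. x \<in> {0..m} \<Longrightarrow> f x \<le> M"
    unfolding bounded_pos by (metis abs_le_D1 imageI real_norm_def)
  define B where "B n i x = Bernstein n i (f x / M)" for n i x
  have B: "continuous_on {0..m} (B n i)" for n i
    unfolding B_def[abs_def] Bernstein_def using M by (intro continuous_intros f) auto
  have B0: "0 \<le> B n i x" if "x \<in> {0..m}" for n i x
    unfolding B_def using M(1) M(2)[OF that] nn[OF that] by (intro Bernstein_nonneg) auto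
  have sumB: "(\<Sum>i\<le>n. B n i x) = 1" for n x
    by (simp add: B_def)
  have choi: "0 \<le> bform (E (\<lambda>x. 1 + f x / l)) w w - 2 * bform (E (\<lambda>x. 1)) w h
      + bform (E (\<lambda>x. l / (f x + l))) h h + e * bform (E (\<lambda>x. 1)) h h" if e: "e > 0" for e
  proof -
    define k where "k x = 1 / (1 + M / l * x)" for x :: real
    have "continuous_on {0..1} k"
      unfolding k_def using M l by (intro continuous_intros) (auto simp: add_nonneg_eq_0_iff)
    from Bernstein_Weierstrass[OF this e] obtain N where
      N: "\<And>n x. N \<le> n \<Longrightarrow> x \<in> {0..1} \<Longrightarrow> \<bar>k x - (\<Sum>i\<le>n. k (i / n) * Bernstein n i x)\<bar> < e"
      by blast
    define n where "n = Suc N"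
    define t where "t i = 1 + M / l * (real i / real n)" for i
    have t: "t i > 0" for i using M l by (simp add: t_def add_pos_nonneg)
    have st: "(\<Sum>i\<le>n. t i * B n i x) = 1 + f x / l" for x
    proof -
      have "(\<Sum>i\<le>n. t i * B n i x) = (\<Sum>i\<le>n. B n i x) + M / (l * n) * (\<Sum>i\<le>n. real i * B n i x)"
        by (simp add: t_def sum.distrib distrib_right sum_distrib_left mult.assoc)
      also have "(\<Sum>i\<le>n. real i * B n i x) = n * (f x / M)"
        unfolding B_def by (rule sum_k_Bernstein)
      finally show ?thesis using M l by (simp add: sumB n_def)
    qed
    have sk: "(\<Sum>i\<le>n. (1 / t i) * B n i x) \<le> l / (f x + l) + e * 1" if x: "x \<in> {0..m}" for x
    proof -
      have "\<bar>k (f x / M) - (\<Sum>i\<le>n. (1 / t i) * B n i x)\<bar> < e"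
        using N[of n "f x / M"] M nn[OF x] x by (simp add: n_def B_def t_def k_def)
      moreover have "k (f x / M) = l / (f x + l)"
        using M l by (simp add: k_def field_simps)
      ultimately show ?thesis by linarith
    qed
    have "0 \<le> t i * bform (E (B n i)) w w - 2 * bform (E (B n i)) w h + (1 / t i) * bform (E (B n i)) h h" for i
    proof -
      have pos: "cstar_positive (E (B n i))" by (rule E_positive[OF B B0])
      have "0 \<le> bform (E (B n i)) (t i *\<^sub>R w - h) (t i *\<^sub>R w - h)"
        by (rule bform_nonneg[OF B B0])
      also have "\<dots> = t i * (t i * bform (E (B n i)) w w - 2 * bform (E (B n i)) w h + (1 / t i) * bform (E (B n i)) h h)"
        unfolding bform_quadratic[OF cstar_positive_selfadjoint[OF pos]]
        using t[of i] by (simp add: field_simps power2_eq_square)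
      finally show ?thesis using t[of i] by (simp add: zero_le_mult_iff)
    qed
    then have "0 \<le> (\<Sum>i\<le>n. t i * bform (E (B n i)) w w - 2 * bform (E (B n i)) w h + (1 / t i) * bform (E (B n i)) h h)"
      by (intro sum_nonneg) auto
    also have "\<dots> = bform (\<Sum>i\<le>n. t i *\<^sub>R E (B n i)) w w - 2 * bform (\<Sum>i\<le>n. 1 *\<^sub>R E (B n i)) w h
        + bform (\<Sum>i\<le>n. (1 / t i) *\<^sub>R E (B n i)) h h"
      by (simp add: bform_sum bform_scaleR sum.distrib sum_subtractf sum_distrib_left)
    also have "\<dots> = bform (E (\<lambda>x. 1 + f x / l)) w w - 2 * bform (E (\<lambda>x. 1)) w h
        + bform (E (\<lambda>x. \<Sum>i\<le>n. (1 / t i) * B n i x)) h h"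
      by (simp only: E_sum[OF B, symmetric] st sumB mult_1_left)
    also have "bform (E (\<lambda>x. \<Sum>i\<le>n. (1 / t i) * B n i x)) h h \<le> bform (E (\<lambda>x. l / (f x + l) + e * 1)) h h"
      by (intro bform_mono sk) (intro continuous_intros B cl)+
    also have "E (\<lambda>x. l / (f x + l) + e * 1) = E (\<lambda>x. l / (f x + l)) + E (\<lambda>x. e * 1)"
      by (intro E_add cl continuous_intros)
    also have "E (\<lambda>x. e * 1) = e *\<^sub>R E (\<lambda>x. 1)"
      by (intro E_scaleR continuous_intros)
    finally show ?thesis by (simp add: bform_add bform_scaleR)
  qed
  have "0 \<le> bform (E (\<lambda>x. 1 + f x / l)) w w - 2 * bform (E (\<lambda>x. 1)) w h
      + bform (E (\<lambda>x. l / (f x + l))) h h" (is "0 \<le> ?A")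
  proof (rule field_le_epsilon)
    fix e :: real assume e: "e > 0"
    define b where "b = bform (E (\<lambda>x. 1)) h h"
    have b: "b \<ge> 0" unfolding b_def by (intro bform_nonneg) auto
    have "0 \<le> ?A + e / (b + 1) * b"
      using choi[of "e / (b + 1)"] e b by (simp add: b_def)
    also have "e / (b + 1) * b \<le> e"
      using e b by (simp add: field_simps)
    finally show "0 \<le> ?A + e" by simp
  qed
  moreover have "E (\<lambda>x. 1 + f x / l) = E (\<lambda>x. 1) + (1 / l) *\<^sub>R E f"
  proof -
    have "continuous_on {0..m} (\<lambda>x. f x / l)" using l by (intro continuous_intros f) auto
    then show ?thesis
      using E_add[of "\<lambda>x. 1" "\<lambda>x. f x / l"] E_scaleR[OF f, of "1 / l"] by simp
  qed
  moreover have "E (\<lambda>x. l / (f x + l)) + E (\<lambda>x. f x / (f x + l)) = E (\<lambda>x. 1)"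
    unfolding E_add[OF cl, symmetric]
  proof (rule E_cong)
    fix x assume "x \<in> {0..m}"
    then have "f x + l \<noteq> 0" using fl by force
    then show "l / (f x + l) + f x / (f x + l) = 1"
      by (simp add: add.commute flip: add_divide_distrib)
  qed (intro continuous_on_add cl)
  then have "E (\<lambda>x. l / (f x + l)) = E (\<lambda>x. 1) - E (\<lambda>x. f x / (f x + l))" by (simp add: algebra_simps)
  moreover have "bform (E (\<lambda>x. 1)) (h - w) (h - w)
      = bform (E (\<lambda>x. 1)) h h - 2 * bform (E (\<lambda>x. 1)) w h + bform (E (\<lambda>x. 1)) w w"
  proof -
    have "star (E (\<lambda>x. 1)) = E (\<lambda>x. 1)"
      by (intro cstar_positive_selfadjoint E_positive) auto
    from bform_quadratic[OF this, of 1 w h] show ?thesis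
      by (simp add: bform_def bounded_linear.linear[OF bounded_linear_bop_apply] linear_diff
        cinner_diff_left cinner_diff_right)
  qed
  ultimately show ?thesis
    by (simp add: bform_add bform_diff bform_scaleR)
qed

end


section \<open>Approximating powers by resolvents\<close>

text \<open>
  The functional equation makes \<open>S z / S 1\<close> equal to \<open>z\<^sup>\<alpha>\<close> at the integer powers of \<open>q\<close>; between them,
  monotonicity gives the bound.
\<close>

lemma powr_self_similar:
  fixes S :: "real \<Rightarrow> real"
  assumes q: "1 < q" and al: "0 < (\<alpha>::real)"
    and scale: "\<And>z. 0 < z \<Longrightarrow> S (q * z) = q powr \<alpha> * S z"
    and mono: "\<And>x y. 0 < x \<Longrightarrow> x \<le> y \<Longrightarrow> S x \<le> S y"
    and S1: "0 < S 1" and z: "0 < z"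
  shows "\<bar>S z / S 1 - z powr \<alpha>\<bar> \<le> (q powr \<alpha> - 1) * z powr \<alpha>"
proof -
  have qn: "S (q powr real n * z) = (q powr real n) powr \<alpha> * S z" if "0 < z" for n z
  proof (induction n)
    case (Suc n)
    have "q powr real (Suc n) * z = q * (q powr real n * z)"
      using q by (simp add: powr_add)
    then show ?case
      using q that Suc scale[of "q powr real n * z"] by (simp add: powr_add powr_mult mult.assoc)
  qed (use q in simp)
  have qi: "S (q powr real_of_int k) = (q powr real_of_int k) powr \<alpha> * S 1" for k
  proof (cases k)
    case (nonneg n)
    then show ?thesis using qn[of 1 n] by simp
  next
    case (neg n)
    have "real_of_int k = - real (Suc n)" using neg by simp
    then have inv: "q powr real_of_int k * q powr real (Suc n) = 1"
      using q by (simp add: powr_minus del: of_nat_Suc)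
    then have "S 1 = (q powr real (Suc n)) powr \<alpha> * S (q powr real_of_int k)"
      using qn[of "q powr real_of_int k" "Suc n"] q by (simp add: mult.commute del: of_nat_Suc)
    moreover have "(q powr real_of_int k) powr \<alpha> * (q powr real (Suc n)) powr \<alpha> = 1"
      using inv by (simp del: of_nat_Suc flip: powr_mult)
    ultimately show ?thesis by (simp add: mult.assoc[symmetric])
  qed
  define k where "k = \<lfloor>log q z\<rfloor>"
  define x where "x = q powr real_of_int k"
  have x0: "0 < x" using q by (simp add: x_def)
  have "x \<le> q powr log q z" "q powr log q z \<le> q powr (real_of_int k + 1)"
    unfolding x_def k_def using q by (auto intro!: powr_mono)
  then have x: "x \<le> z" "z \<le> q * x"
    using q z by (simp_all add: x_def powr_add mult.commute)
  have "S x \<le> S z" "S z \<le> S (q * x)"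
    using x x0 by (intro mono; simp)+
  then have "x powr \<alpha> \<le> S z / S 1" "S z / S 1 \<le> q powr \<alpha> * x powr \<alpha>"
    using qi[of k] scale[OF x0] S1 by (simp_all add: x_def field_simps)
  moreover have "x powr \<alpha> \<le> z powr \<alpha>" "z powr \<alpha> \<le> q powr \<alpha> * x powr \<alpha>"
    using x x0 q al z by (auto intro!: powr_mono2 simp flip: powr_mult)
  moreover have "(q powr \<alpha> - 1) * x powr \<alpha> \<le> (q powr \<alpha> - 1) * z powr \<alpha>"
    using calculation(3) q al by (intro mult_left_mono) (simp_all add: ge_one_powr_ge_zero)
  ultimately show ?thesis
    by (simp add: abs_le_iff left_diff_distrib)
qed

text \<open>
  The sum \<open>S z = (\<Sum>k\<in>\<int>. q\<^sup>\<alpha>\<^sup>k z / (z + q\<^sup>k))\<close> is increasing and satisfies \<open>S (q z) = q\<^sup>\<alpha> S z\<close>, so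
  \<open>S z / S 1\<close> differs from \<open>z\<^sup>\<alpha>\<close> by a factor between \<open>q\<^sup>-\<^sup>\<alpha>\<close> and \<open>q\<^sup>\<alpha>\<close>.  For \<open>q\<close> close to \<open>1\<close>, a
  partial sum of \<open>S\<close>, divided by \<open>S 1\<close>, is the required combination.  It is a Riemann sum of the
  integral of \<open>\<lambda>\<^sup>\<alpha>\<^sup>-\<^sup>1 z / (z + \<lambda>)\<close> over \<open>\<lambda> > 0\<close> along a geometric grid.
\<close>

lemma powr_resolvent_approx:
  fixes \<alpha> M e :: real
  assumes al: "0 < \<alpha>" "\<alpha> < 1" and M: "0 < M" and e: "0 < e"
  shows "\<exists>(A::nat set) w l. finite A \<and> (\<forall>i\<in>A. 0 \<le> w i \<and> 0 < l i) \<and>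
    (\<forall>z\<in>{0..M}. \<bar>(\<Sum>i\<in>A. w i * (z / (z + l i))) - z powr \<alpha>\<bar> \<le> e)"
proof -
  define q where "q = (1 + e / (2 * M powr \<alpha>)) powr (1 / \<alpha>)"
  have q\<alpha>: "q powr \<alpha> = 1 + e / (2 * M powr \<alpha>)"
    using al M e by (simp add: q_def powr_powr add_pos_pos)
  have q: "1 < q"
    unfolding q_def using al M e by (intro gr_one_powr) auto
  \<comment> \<open>Here \<open>u z n\<close> is the term for \<open>k = n\<close> and \<open>v z n\<close> the term for \<open>k = - (n + 1)\<close>.\<close>
  define lu where "lu n = q powr real n" for n
  define lv where "lv n = q powr (- real (Suc n))" for n
  define u where "u z n = lu n powr \<alpha> * (z / (z + lu n))" for z n
  define v where "v z n = lv n powr \<alpha> * (z / (z + lv n))" for z n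
  have l0: "0 < lu n" "0 < lv n" for n using q by (simp_all add: lu_def lv_def)
  define r where "r = q powr (\<alpha> - 1)"
  define s where "s = q powr (- \<alpha>)"
  have rs: "0 < r" "r < 1" "0 < s" "s < 1"
    using q al by (simp_all add: r_def s_def powr_less_one)
  have ub: "norm (u z n) \<le> b * r ^ n" and vb: "norm (v z n) \<le> s ^ n"
    if "0 \<le> z" "z \<le> b" for z b n
  proof -
    have "lu n powr \<alpha> * (z / (z + lu n)) \<le> lu n powr \<alpha> * (b / lu n)"
      using that l0[of n] by (intro mult_left_mono frac_le) auto
    also have "\<dots> = b * lu n powr (\<alpha> - 1)"
      using l0[of n] by (simp add: powr_diff)
    also have "lu n powr (\<alpha> - 1) = r ^ n"
      using q rs by (simp add: lu_def r_def powr_powr mult.commute flip: powr_realpow)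
    finally show "norm (u z n) \<le> b * r ^ n"
      using that l0[of n] by (simp add: u_def)
    have lv: "lv n powr \<alpha> = s ^ Suc n"
      unfolding powr_realpow[OF rs(3), symmetric] by (simp add: lv_def s_def powr_powr algebra_simps)
    have "lv n powr \<alpha> * (z / (z + lv n)) \<le> lv n powr \<alpha> * 1"
      using that l0[of n] by (intro mult_left_mono) (auto simp: divide_le_eq_1)
    also have "\<dots> \<le> s ^ n"
      using rs by (simp add: lv mult_left_le_one_le)
    finally show "norm (v z n) \<le> s ^ n"
      using that l0[of n] by (simp add: v_def)
  qed
  have su: "summable (u z)" and sv: "summable (v z)" if "0 \<le> z" for z
  proof -
    have "summable (\<lambda>n. z * r ^ n)" using rs by (intro summable_mult summable_geometric) simp
    then show "summable (u z)"
      by (rule summable_comparison_test') (rule ub[OF that order_refl])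
    have "summable (\<lambda>n. s ^ n)" using rs by (intro summable_geometric) simp
    then show "summable (v z)"
      by (rule summable_comparison_test') (rule vb[OF that order_refl])
  qed
  define S where "S z = suminf (u z) + suminf (v z)" for z
  have scale: "S (q * z) = q powr \<alpha> * S z" if z: "0 < z" for z
  proof -
    have uS: "u (q * z) (Suc n) = q powr \<alpha> * u z n" for n
    proof -
      have "lu (Suc n) = q * lu n" using q by (simp add: lu_def powr_add)
      moreover have "q * z / (q * z + q * lu n) = z / (z + lu n)"
        using q by (simp flip: distrib_left)
      ultimately show ?thesis
        using q l0[of n] by (simp add: u_def powr_mult)
    qed
    have vS: "v (q * z) = (\<lambda>n. q powr \<alpha> * v z (Suc n))"
    proof
      fix n
      have "lv n = q * lv (Suc n)" using q by (simp add: lv_def powr_add[symmetric] powr_mult_base)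
      moreover have "q * z / (q * z + q * lv (Suc n)) = z / (z + lv (Suc n))"
        using q by (simp flip: distrib_left)
      ultimately show "v (q * z) n = q powr \<alpha> * v z (Suc n)"
        using q l0[of "Suc n"] by (simp add: v_def powr_mult)
    qed
    have mid: "u (q * z) 0 = q powr \<alpha> * v z 0"
    proof -
      have "lu 0 = q * lv 0" using q by (simp add: lu_def lv_def powr_mult_base)
      moreover have "q * z / (q * z + q * lv 0) = z / (z + lv 0)"
        using q by (simp flip: distrib_left)
      ultimately show ?thesis
        using q l0[of 0] by (simp add: u_def v_def powr_mult)
    qed
    have qz: "0 \<le> q * z" using q z by simp
    have "suminf (u (q * z)) = q powr \<alpha> * (v z 0 + suminf (u z))"
      using suminf_split_head[OF su[OF qz]] suminf_mult[OF su[of z], of "q powr \<alpha>"] z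
      by (simp add: uS mid distrib_left)
    moreover have "suminf (v (q * z)) = q powr \<alpha> * (suminf (v z) - v z 0)"
      using suminf_split_head[OF sv[of z]] z suminf_mult[of "\<lambda>n. v z (Suc n)" "q powr \<alpha>"] sv[of z]
      by (simp add: vS summable_Suc_iff)
    ultimately show ?thesis by (simp add: S_def algebra_simps)
  qed
  have frac_mono: "x / (x + l) \<le> y / (y + l)" if "0 < x" "x \<le> y" "0 < l" for x y l :: real
    using that by (simp add: field_simps)
  have mono: "S x \<le> S y" if "0 < x" "x \<le> y" for x y
    unfolding S_def using that l0
    by (intro add_mono suminf_le su sv) (auto simp only: u_def v_def powr_ge_zero intro!: mult_left_mono frac_mono)
  have S1: "0 < S 1"
  proof -
    have "0 < u 1 n" "0 < v 1 n" for n
      using l0[of n] by (simp_all add: u_def v_def add_pos_pos)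
    then show ?thesis
      unfolding S_def by (intro add_pos_pos suminf_pos su sv) auto
  qed
  have close: "\<bar>S z / S 1 - z powr \<alpha>\<bar> \<le> e / 2" if "z \<in> {0..M}" for z
  proof (cases "z = 0")
    case True
    then have "u z = (\<lambda>n. 0)" "v z = (\<lambda>n. 0)" by (auto simp: u_def v_def)
    then show ?thesis using True e by (simp add: S_def)
  next
    case False
    with that have z: "0 < z" "z \<le> M" by auto
    have "\<bar>S z / S 1 - z powr \<alpha>\<bar> \<le> (q powr \<alpha> - 1) * z powr \<alpha>"
      by (rule powr_self_similar[OF q al(1) scale mono S1 z(1)])
    also have "\<dots> \<le> (q powr \<alpha> - 1) * M powr \<alpha>"
      using z al M e by (intro mult_left_mono powr_mono2) (auto simp: q\<alpha>)
    also have "\<dots> = e / 2"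
      using M by (simp add: q\<alpha>)
    finally show ?thesis .
  qed
  have "uniform_limit {0..M} (\<lambda>N z. \<Sum>n<N. u z n) (\<lambda>z. \<Sum>n. u z n) sequentially"
    by (rule Weierstrass_m_test[where M = "\<lambda>n. M * r ^ n"]) (use ub rs in \<open>auto intro!: summable_mult\<close>)
  moreover have "uniform_limit {0..M} (\<lambda>N z. \<Sum>n<N. v z n) (\<lambda>z. \<Sum>n. v z n) sequentially"
    by (rule Weierstrass_m_test[where M = "\<lambda>n. s ^ n"]) (use vb rs in auto)
  ultimately have "uniform_limit {0..M} (\<lambda>N z. (\<Sum>n<N. u z n) + (\<Sum>n<N. v z n)) S sequentially"
    unfolding S_def[abs_def] by (rule uniform_limit_add)
  moreover have "0 < e / 2 * S 1" using e S1 by simp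
  ultimately obtain N where N: "\<And>z. z \<in> {0..M} \<Longrightarrow> dist ((\<Sum>n<N. u z n) + (\<Sum>n<N. v z n)) (S z) < e / 2 * S 1"
    unfolding uniform_limit_sequentially_iff by (metis order_refl)
  define l where "l i = (if i < N then lu i else lv (i - N))" for i
  define w where "w i = l i powr \<alpha> / S 1" for i
  have split: "(\<Sum>i<n + k. f i) = (\<Sum>i<n. f i) + (\<Sum>i<k. f (n + i))" for f :: "nat \<Rightarrow> real" and n k
    by (induction k) simp_all
  have sum_eq: "(\<Sum>i<N + N. w i * (z / (z + l i))) = ((\<Sum>n<N. u z n) + (\<Sum>n<N. v z n)) / S 1" for z
  proof -
    have "(\<Sum>i<N + N. w i * (z / (z + l i)))
        = (\<Sum>i<N. w i * (z / (z + l i))) + (\<Sum>i<N. w (N + i) * (z / (z + l (N + i))))"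
      using split[of _ N N] .
    then show ?thesis
      by (simp add: w_def l_def u_def v_def add_divide_distrib sum_divide_distrib mult_ac)
  qed
  have "\<bar>(\<Sum>i<N + N. w i * (z / (z + l i))) - z powr \<alpha>\<bar> \<le> e" if z: "z \<in> {0..M}" for z
  proof -
    have "\<bar>((\<Sum>n<N. u z n) + (\<Sum>n<N. v z n)) / S 1 - S z / S 1\<bar> < e / 2"
      using N[OF z] S1 by (simp add: dist_real_def divide_less_eq flip: diff_divide_distrib)
    with close[OF z] show ?thesis unfolding sum_eq by linarith
  qed
  moreover have "0 \<le> w i \<and> 0 < l i" for i
    using l0 S1 by (simp add: w_def l_def)
  ultimately show ?thesis by (intro exI[of _ "{..<N + N}"] exI[of _ w] exI[of _ l]) auto
qed


lemma continuous_on_powr_nonneg: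
  fixes f :: "real \<Rightarrow> real"
  assumes "continuous_on S f" "\<And>x. x \<in> S \<Longrightarrow> 0 \<le> f x" "0 < \<alpha>"
  shows "continuous_on S (\<lambda>x. f x powr \<alpha>)"
  using assms by (intro continuous_on_powr') auto

section \<open>Powers under positive maps\<close>

text \<open>
  An inequality between two positive maps passes from the functions \<open>x / (x + l)\<close> to the powers with
  exponent in \<open>(0, 1)\<close>, by uniform approximation.
\<close>

lemma bform_powr_le:
  assumes "positive_operator_map m E" "positive_operator_map n F"
    and f: "continuous_on {0..m} f" "\<And>x. x \<in> {0..m} \<Longrightarrow> 0 \<le> f x"
    and g: "continuous_on {0..n} g" "\<And>x. x \<in> {0..n} \<Longrightarrow> 0 \<le> g x"
    and al: "0 < \<alpha>" "\<alpha> < 1"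
    and le: "\<And>l. 0 < l \<Longrightarrow>
      bform (E (\<lambda>x. f x / (f x + l))) v v \<le> bform (F (\<lambda>x. g x / (g x + l))) v v"
  shows "bform (E (\<lambda>x. f x powr \<alpha>)) v v \<le> bform (F (\<lambda>x. g x powr \<alpha>)) v v"
proof (rule field_le_epsilon)
  interpret E: positive_operator_map m E by fact
  interpret F: positive_operator_map n F by fact
  define b where "b = bform (E (\<lambda>x. 1)) v v + bform (F (\<lambda>x. 1)) v v"
  have b: "0 \<le> b"
    unfolding b_def by (intro add_nonneg_nonneg E.bform_nonneg F.bform_nonneg) auto
  have "bounded (f ` {0..m} \<union> g ` {0..n})"
    unfolding bounded_Un
    by (intro conjI compact_imp_bounded compact_continuous_image f g) simp_all
  then obtain M where M: "0 < M" "\<And>y. y \<in> f ` {0..m} \<union> g ` {0..n} \<Longrightarrow> norm y \<le> M"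
    unfolding bounded_pos by blast
  have fM: "f x \<in> {0..M}" if "x \<in> {0..m}" for x
    using M(2)[of "f x"] f(2)[OF that] that by auto
  have gM: "g x \<in> {0..M}" if "x \<in> {0..n}" for x
    using M(2)[of "g x"] g(2)[OF that] that by auto
  fix \<epsilon> :: real assume \<epsilon>: "0 < \<epsilon>"
  define e where "e = \<epsilon> / (b + 1)"
  have e: "0 < e" using \<epsilon> b by (simp add: e_def)
  obtain A :: "nat set" and w l where wl: "\<And>i. i \<in> A \<Longrightarrow> 0 \<le> w i" "\<And>i. i \<in> A \<Longrightarrow> 0 < l i"
    and approx: "\<And>z. z \<in> {0..M} \<Longrightarrow> \<bar>(\<Sum>i\<in>A. w i * (z / (z + l i))) - z powr \<alpha>\<bar> \<le> e"
    using powr_resolvent_approx[OF al M(1) e] by metis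
  have cf: "continuous_on {0..m} (\<lambda>x. f x / (f x + l i))" if "i \<in> A" for i
    using f(2) wl(2)[OF that] by (intro continuous_intros f(1)) (force simp: add_nonneg_eq_0_iff)
  have cg: "continuous_on {0..n} (\<lambda>x. g x / (g x + l i))" if "i \<in> A" for i
    using g(2) wl(2)[OF that] by (intro continuous_intros g(1)) (force simp: add_nonneg_eq_0_iff)
  have cf\<alpha>: "continuous_on {0..m} (\<lambda>x. f x powr \<alpha>)" and cg\<alpha>: "continuous_on {0..n} (\<lambda>x. g x powr \<alpha>)"
    by (intro continuous_on_powr_nonneg f g al; simp)+
  have cfS: "continuous_on {0..m} (\<lambda>x. \<Sum>i\<in>A. w i * (f x / (f x + l i)))"
    by (intro continuous_on_sum continuous_on_mult_left cf)
  have cgS: "continuous_on {0..n} (\<lambda>x. \<Sum>i\<in>A. w i * (g x / (g x + l i)))"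
    by (intro continuous_on_sum continuous_on_mult_left cg)
  have "bform (E (\<lambda>x. f x powr \<alpha>)) v v
      \<le> bform (E (\<lambda>x. (\<Sum>i\<in>A. w i * (f x / (f x + l i))) + e * 1)) v v"
  proof (rule E.bform_mono[OF cf\<alpha>])
    fix x assume "x \<in> {0..m}"
    then show "f x powr \<alpha> \<le> (\<Sum>i\<in>A. w i * (f x / (f x + l i))) + e * 1"
      using approx[OF fM] by (fastforce simp: abs_le_iff)
  qed (intro continuous_intros cfS)
  also have "\<dots> = (\<Sum>i\<in>A. w i * bform (E (\<lambda>x. f x / (f x + l i))) v v) + e * bform (E (\<lambda>x. 1)) v v"
    by (subst E.E_add[OF cfS])
       (simp_all only: E.E_scaleR E.E_sum[OF cf] continuous_on_const bform_add bform_sum bform_scaleR)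
  also have "\<dots> \<le> (\<Sum>i\<in>A. w i * bform (F (\<lambda>x. g x / (g x + l i))) v v) + e * bform (E (\<lambda>x. 1)) v v"
    by (intro add_right_mono sum_mono mult_left_mono le wl)
  also have "(\<Sum>i\<in>A. w i * bform (F (\<lambda>x. g x / (g x + l i))) v v)
      = bform (F (\<lambda>x. \<Sum>i\<in>A. w i * (g x / (g x + l i)))) v v"
    by (simp only: F.E_sum[OF cg] bform_sum bform_scaleR)
  also have "\<dots> \<le> bform (F (\<lambda>x. g x powr \<alpha> + e * 1)) v v"
  proof (rule F.bform_mono[OF cgS])
    fix x assume "x \<in> {0..n}"
    then show "(\<Sum>i\<in>A. w i * (g x / (g x + l i))) \<le> g x powr \<alpha> + e * 1"
      using approx[OF gM] by (fastforce simp: abs_le_iff)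
  qed (intro continuous_intros cg\<alpha>)
  also have "\<dots> = bform (F (\<lambda>x. g x powr \<alpha>)) v v + e * bform (F (\<lambda>x. 1)) v v"
    by (subst F.E_add[OF cg\<alpha>])
       (simp_all only: F.E_scaleR continuous_on_const bform_add bform_scaleR)
  finally have "bform (E (\<lambda>x. f x powr \<alpha>)) v v \<le> bform (F (\<lambda>x. g x powr \<alpha>)) v v + e * b"
    by (simp add: b_def distrib_left)
  also have "e * b \<le> \<epsilon>"
    using \<epsilon> b by (simp add: e_def field_simps)
  finally show "bform (E (\<lambda>x. f x powr \<alpha>)) v v \<le> bform (F (\<lambda>x. g x powr \<alpha>)) v v + \<epsilon>"
    by simp
qed

lemma positive_operator_map_rfc:
  assumes \<phi>: "clinear \<phi>" "positive_map \<phi>" and pos: "cstar_positive a"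
  shows "positive_operator_map (norm a) (\<lambda>f. \<phi> (rfc a f))"
proof
  fix f g :: "real \<Rightarrow> real" and c
  assume f: "continuous_on {0..norm a} f"
  show "\<phi> (rfc a f) = \<phi> (rfc a g)" if "\<And>x. x \<in> {0..norm a} \<Longrightarrow> f x = g x"
  proof -
    have "rfc a f = rfc a g" by (rule rfc_cong[OF pos f]) (rule that)
    then show ?thesis by simp
  qed
  show "\<phi> (rfc a (\<lambda>x. f x + g x)) = \<phi> (rfc a f) + \<phi> (rfc a g)" if "continuous_on {0..norm a} g"
    using \<phi>(1) by (simp add: rfc_add[OF pos f that] clinear_def)
  show "\<phi> (rfc a (\<lambda>x. c * f x)) = c *\<^sub>R \<phi> (rfc a f)"
    using \<phi>(1) by (simp add: rfc_scaleR[OF pos f] clinear_def scaleR_scaleC)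
  show "cstar_positive (\<phi> (rfc a f))" if "\<And>x. x \<in> {0..norm a} \<Longrightarrow> 0 \<le> f x"
    using \<phi>(2) rfc_positive[OF pos f that] by (simp add: positive_map_def)
qed

lemma
  shows clinear_ident: "clinear (\<lambda>x. x)"
    and positive_map_ident: "positive_map (\<lambda>x. x)"
    and contractive_ident: "contractive (\<lambda>x. x)"
  by (simp_all add: clinear_def positive_map_def contractive_def bounded_linear_ident onorm_id_le)

text \<open>
  If \<open>E\<close> is the functional calculus of an operator, equality holds in \<open>bform_resolvent_le\<close> for
  \<open>w = l (g(Y) + l)\<^sup>-\<^sup>1 v\<close>.
\<close>

lemma rfc_resolvent_attained:
  fixes Y :: "'h::complex_hilbert_space bop"
  assumes Y: "cstar_positive Y" and g: "continuous_on {0..norm Y} g"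
    and nn: "\<And>x. x \<in> {0..norm Y} \<Longrightarrow> 0 \<le> g x" and l: "0 < l"
  shows "\<exists>w. bform (rfc Y g) w w / l + (norm (v - w))\<^sup>2 = bform (rfc Y (\<lambda>x. g x / (g x + l))) v v"
proof -
  let ?I = "{0..norm Y}"
  define d where "d x = l / (g x + l)" for x
  define p where "p x = g x / (g x + l)" for x
  have gl: "g x + l \<noteq> 0" if "x \<in> ?I" for x using nn[OF that] l by simp
  have d: "continuous_on ?I d" and p: "continuous_on ?I p"
    unfolding d_def p_def using gl by (intro continuous_intros g; blast)+
  define D where "D = rfc Y d"
  define w where "w = bop_apply D v"
  have "D + rfc Y p = 1"
    unfolding D_def rfc_add[OF Y d p, symmetric] rfc_one[OF Y, symmetric]
  proof (rule rfc_cong[OF Y])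
    fix x assume "x \<in> ?I"
    then show "d x + p x = 1"
      using gl[of x] by (simp add: d_def p_def add.commute flip: add_divide_distrib)
  qed (intro continuous_on_add d p)
  then have "v - w = bop_apply (rfc Y p) v"
    unfolding w_def by (metis add_diff_cancel_left' bop_apply_add_left bop_apply_one)
  then have "(norm (v - w))\<^sup>2 = bform 1 (bop_apply (rfc Y p) v) (bop_apply (rfc Y p) v)"
    by (simp add: bform_one)
  also have "\<dots> = bform (rfc Y p * 1 * rfc Y p) v v"
    by (rule bform_conj[OF rfc_selfadjoint[OF Y p], symmetric])
  also have "rfc Y p * 1 * rfc Y p = rfc Y (\<lambda>x. p x * p x)"
    by (simp only: rfc_mult[OF Y p p] mult.right_neutral)
  finally have 1: "(norm (v - w))\<^sup>2 = bform (rfc Y (\<lambda>x. p x * p x)) v v" .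
  have dg: "continuous_on ?I (\<lambda>x. d x * g x)" and dgd: "continuous_on ?I (\<lambda>x. d x * g x * d x)"
    and pp: "continuous_on ?I (\<lambda>x. p x * p x)"
    by (intro continuous_intros d p g)+
  have "bform (rfc Y g) w w = bform (D * rfc Y g * D) v v"
    unfolding w_def D_def by (rule bform_conj[OF rfc_selfadjoint[OF Y d], symmetric])
  also have "D * rfc Y g * D = rfc Y (\<lambda>x. d x * g x * d x)"
    by (simp only: D_def rfc_mult[OF Y d g] rfc_mult[OF Y dg d])
  finally have "bform (rfc Y g) w w / l + (norm (v - w))\<^sup>2
      = bform ((1 / l) *\<^sub>R rfc Y (\<lambda>x. d x * g x * d x) + rfc Y (\<lambda>x. p x * p x)) v v"
    using 1 by (simp add: bform_add bform_scaleR)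
  also have "(1 / l) *\<^sub>R rfc Y (\<lambda>x. d x * g x * d x) + rfc Y (\<lambda>x. p x * p x)
      = rfc Y (\<lambda>x. (1 / l) * (d x * g x * d x) + p x * p x)"
    by (simp only: rfc_scaleR[OF Y dgd] rfc_add[OF Y continuous_on_mult_left[OF dgd] pp])
  also have "\<dots> = rfc Y p"
  proof (rule rfc_cong[OF Y])
    fix x assume "x \<in> ?I"
    then have "g x + l \<noteq> 0" by (rule gl)
    have "(1 / l) * (d x * g x * d x) + p x * p x = (g x * (g x + l)) / ((g x + l) * (g x + l))"
      using l by (simp add: d_def p_def add_divide_distrib distrib_left mult_ac)
    then show "(1 / l) * (d x * g x * d x) + p x * p x = p x"
      using \<open>g x + l \<noteq> 0\<close> by (simp add: p_def)
  qed (intro continuous_intros dgd pp)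
  finally show ?thesis unfolding p_def[abs_def] by blast
qed

text \<open>
  For \<open>\<phi>\<close> the identity this is operator monotonicity of powers (Loewner and Heinz), and for
  \<open>Y = \<phi>(f(a))\<close> and \<open>g\<close> the identity it is Jensen's inequality for the power function.
\<close>

lemma positive_map_powr_le:
  fixes \<phi> :: "'a::unital_cstar_algebra \<Rightarrow> 'h::complex_hilbert_space bop"
  assumes \<phi>: "clinear \<phi>" "positive_map \<phi>" "contractive \<phi>"
    and a: "cstar_positive a" and Y: "cstar_positive Y"
    and f: "continuous_on {0..norm a} f" "\<And>x. x \<in> {0..norm a} \<Longrightarrow> 0 \<le> f x"
    and g: "continuous_on {0..norm Y} g" "\<And>x. x \<in> {0..norm Y} \<Longrightarrow> 0 \<le> g x"
    and le: "\<phi> (rfc a f) \<preceq> rfc Y g" and al: "0 < \<alpha>" "\<alpha> \<le> 1"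
  shows "\<phi> (rfc a (\<lambda>x. f x powr \<alpha>)) \<preceq> rfc Y (\<lambda>x. g x powr \<alpha>)"
proof -
  interpret E: positive_operator_map "norm a" "\<lambda>f. \<phi> (rfc a f)"
    by (rule positive_operator_map_rfc[OF \<phi>(1,2) a])
  interpret F: positive_operator_map "norm Y" "rfc Y"
    by (rule positive_operator_map_rfc[OF clinear_ident positive_map_ident Y])
  have sa: "star (\<phi> (rfc a k)) = \<phi> (rfc a k)"
    if "continuous_on {0..norm a} k" "\<And>x. x \<in> {0..norm a} \<Longrightarrow> 0 \<le> k x" for k
    by (rule cstar_positive_selfadjoint[OF E.E_positive[OF that]])
  have le': "bform (\<phi> (rfc a f)) v v \<le> bform (rfc Y g) v v" for v
    using le cstar_le_bop_iff[OF sa[OF f] rfc_selfadjoint[OF Y g(1)]] by blast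
  have "norm (\<phi> 1) \<le> 1"
  proof -
    have "norm (\<phi> 1) \<le> onorm \<phi> * norm (1::'a)"
      using \<phi>(3) by (intro onorm) (simp add: contractive_def)
    also have "\<dots> \<le> 1 * 1"
      using \<phi>(3) norm_one_le[where 'a = 'a] by (intro mult_mono) (auto simp: contractive_def)
    finally show ?thesis by simp
  qed
  then have one: "bform (\<phi> (rfc a (\<lambda>x. 1))) v v \<le> (norm v)\<^sup>2" for v
    using bform_le[of "\<phi> 1" v] mult_right_mono[of "norm (\<phi> 1)" 1 "(norm v)\<^sup>2"]
    by (simp add: rfc_one[OF a])
  have "bform (\<phi> (rfc a (\<lambda>x. f x powr \<alpha>))) v v \<le> bform (rfc Y (\<lambda>x. g x powr \<alpha>)) v v" for v
  proof (cases "\<alpha> = 1")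
    case True
    have "rfc a (\<lambda>x. f x powr \<alpha>) = rfc a f"
      by (rule rfc_cong[OF a f(1), symmetric]) (use f(2) True in auto)
    moreover have "rfc Y (\<lambda>x. g x powr \<alpha>) = rfc Y g"
      by (rule rfc_cong[OF Y g(1), symmetric]) (use g(2) True in auto)
    ultimately show ?thesis using le' by simp
  next
    case False
    with al have "\<alpha> < 1" by simp
    show ?thesis
    proof (rule bform_powr_le[OF E.positive_operator_map_axioms F.positive_operator_map_axioms f g al(1)])
      fix l :: real assume l: "0 < l"
      obtain w where w: "bform (rfc Y g) w w / l + (norm (v - w))\<^sup>2
          = bform (rfc Y (\<lambda>x. g x / (g x + l))) v v"
        using rfc_resolvent_attained[OF Y g l] by blast
      have "bform (\<phi> (rfc a (\<lambda>x. f x / (f x + l)))) v v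
          \<le> bform (\<phi> (rfc a f)) w w / l + bform (\<phi> (rfc a (\<lambda>x. 1))) (v - w) (v - w)"
        by (rule E.bform_resolvent_le[OF f l])
      also have "\<dots> \<le> bform (rfc Y g) w w / l + (norm (v - w))\<^sup>2"
        using l by (intro add_mono divide_right_mono le' one) simp
      finally show "bform (\<phi> (rfc a (\<lambda>x. f x / (f x + l)))) v v
          \<le> bform (rfc Y (\<lambda>x. g x / (g x + l))) v v"
        unfolding w .
    qed (use \<open>\<alpha> < 1\<close> in simp_all)
  qed
  then show ?thesis
    by (subst cstar_le_bop_iff)
       (auto intro!: sa rfc_selfadjoint[OF Y] continuous_on_powr_nonneg f g al(1))
qed

theorem proposition6p2:
  fixes \<phi> :: "'a::unital_cstar_algebra \<Rightarrow> 'h::complex_hilbert_space bop"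
    and r s :: real
  assumes "clinear \<phi>" and "positive_map \<phi>" and "contractive \<phi>"
    and "1 \<le> r" and "r \<le> s"
  shows "\<forall>a. cstar_positive a \<longrightarrow>
    cstar_powr (\<phi> (cstar_powr a r)) (1 / r) \<preceq> cstar_powr (\<phi> (cstar_powr a s)) (1 / s)"
proof (intro allI impI)
  fix a :: 'a
  assume a: "cstar_positive a"
  have cont: "continuous_on {0..b} (\<lambda>x. x powr t)" if "0 < t" for b t :: real
    using that by (intro continuous_on_powr_nonneg) auto
  have pos: "cstar_positive (\<phi> (rfc a (\<lambda>x. x powr t)))" if "0 < t" for t
    using assms(2) rfc_positive[OF a cont[OF that]] by (simp add: positive_map_def)
  define X where "X = \<phi> (rfc a (\<lambda>x. x powr r))"
  define Y where "Y = \<phi> (rfc a (\<lambda>x. x powr s))"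
  have X: "cstar_positive X" and Y: "cstar_positive Y"
    unfolding X_def Y_def using assms by (intro pos; simp)+
  \<comment> \<open>Jensen's inequality for the exponent \<open>r / s\<close>.\<close>
  have "Y \<preceq> rfc Y (\<lambda>x. x)"
    using Y by (simp add: rfc_id cstar_le_bop_iff cstar_positive_selfadjoint)
  then have "\<phi> (rfc a (\<lambda>x. (x powr s) powr (r / s))) \<preceq> rfc Y (\<lambda>x. x powr (r / s))"
    unfolding Y_def using assms
    by (intro positive_map_powr_le a Y[unfolded Y_def] cont) auto
  also have "(\<lambda>x. (x powr s) powr (r / s)) = (\<lambda>x. x powr r)"
    using assms by (simp add: powr_powr)
  finally have "rfc X (\<lambda>x. x) \<preceq> rfc Y (\<lambda>x. x powr (r / s))"
    unfolding X_def rfc_id[OF X[unfolded X_def]] .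
  \<comment> \<open>Monotonicity for the exponent \<open>1 / r\<close>.\<close>
  then have "rfc X (\<lambda>x. x powr (1 / r)) \<preceq> rfc Y (\<lambda>x. (x powr (r / s)) powr (1 / r))"
    using assms
    by (intro positive_map_powr_le[where \<phi> = "\<lambda>x. x"] clinear_ident positive_map_ident contractive_ident
        X Y cont) auto
  also have "(\<lambda>x. (x powr (r / s)) powr (1 / r)) = (\<lambda>x. x powr (1 / s))"
    using assms by (simp add: powr_powr)
  finally show "cstar_powr (\<phi> (cstar_powr a r)) (1 / r) \<preceq> cstar_powr (\<phi> (cstar_powr a s)) (1 / s)"
    by (simp add: cstar_powr_eq_rfc X_def Y_def)
qed

end
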